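(* Let $H$ be a Hopf algebra over a commutative ring $k$, with counit $\varepsilon$, and let $G:\mathcal{M}_H\to\mathcal{M}_k$ be the restriction of scalars functor from right $H$-modules to $k$-modules. The following assertions are equivalent: 1) $G$ is a dual Maschke functor; 2) $G$ is a Maschke functor; 3) $G$ is a semisimple functor; 4) there exists a right integral $t\in H$ with $\varepsilon(t)=1$; 5) $G$ is a separable functor.
   Context: A right integral in $H$ is an element $t\in H$ with $th=\varepsilon(h)t$ for all $h\in H$. Let $F:\mathcal{C}\to\mathcal{D}$ be a functor. - $F$ is separable if there is a family of maps $\mathcal{P}_{C,C'}:\mathrm{Hom}_{\mathcal{D}}(F(C),F(C'))\to\mathrm{Hom}_{\mathcal{C}}(C,C')$, natural in $C,C'$ (i.e. $\mathcal{P}_{X,T}(F(v)\circ h\circ F(u))=v\circ\mathcal{P}_{Y,Z}(h)\circ u$ for $u:X\to Y$, $v:Z\to T$ in $\mathcal{C}$, $h:F(Y)\to F(Z)$ in $\mathcal{D}$), with $\mathcal{P}_{C,C'}(F(f))=f$ for all $f:C\to C'$. - $F$ is a Maschke functor if every $M\in\mathcal{C}$ is $F$-relative injective: for every $i:C\to C'$ in $\mathcal{C}$ such that $F(i)$ has a left inverse in $\mathcal{D}$ and every $f:C\to M$, there is $g:C'\to M$ in $\mathcal{C}$ with $f=g\circ i$. - $F$ is a dual Maschke functor if every $P\in\mathcal{C}$ is $F$-relative projective: for every $p:C'\to C$ in $\mathcal{C}$ such that $F(p)$ has a right inverse in $\mathcal{D}$ and every $f:P\to C$, there is $g:P\to C'$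 in $\mathcal{C}$ with $f=p\circ g$. - For $\mathcal{C},\mathcal{D}$ abelian, $F$ is semisimple if every exact sequence $0\to C'\to C\to C''\to0$ in $\mathcal{C}$ for which $0\to F(C')\to F(C)\to F(C'')\to0$ is split exact in $\mathcal{D}$ is itself split exact in $\mathcal{C}$. *)

theory Defs
  imports "HOL-Algebra.Module" "HOL-Algebra.Generated_Groups" "HOL-Algebra.Free_Abelian_Groups"
begin

section \<open>Categories and functors\<close>

text \<open>Arrows are typed: \<open>Arr C X Y\<close> is the hom-set, and \<open>Comp C X Y Z g f\<close> is the composite of
  \<open>f : X \<rightarrow> Y\<close> followed by \<open>g : Y \<rightarrow> Z\<close>. Hom-sets of different pairs of objects need not be disjoint.\<close>

record ('o, 'f) cat =
  Obj :: "'o set"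
  Arr :: "'o \<Rightarrow> 'o \<Rightarrow> 'f set"
  Comp :: "'o \<Rightarrow> 'o \<Rightarrow> 'o \<Rightarrow> 'f \<Rightarrow> 'f \<Rightarrow> 'f"
  Ident :: "'o \<Rightarrow> 'f"

locale is_category =
  fixes C :: "('o, 'f) cat"
  assumes Ident_in: "X \<in> Obj C \<Longrightarrow> Ident C X \<in> Arr C X X"
    and Comp_in: "\<lbrakk>X \<in> Obj C; Y \<in> Obj C; Z \<in> Obj C; f \<in> Arr C X Y; g \<in> Arr C Y Z\<rbrakk>
      \<Longrightarrow> Comp C X Y Z g f \<in> Arr C X Z"
    and Comp_Ident: "\<lbrakk>X \<in> Obj C; Y \<in> Obj C; f \<in> Arr C X Y\<rbrakk> \<Longrightarrow> Comp C X X Y f (Ident C X) = f"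
    and Ident_Comp: "\<lbrakk>X \<in> Obj C; Y \<in> Obj C; f \<in> Arr C X Y\<rbrakk> \<Longrightarrow> Comp C X Y Y (Ident C Y) f = f"
    and Comp_assoc: "\<lbrakk>X \<in> Obj C; Y \<in> Obj C; Z \<in> Obj C; W \<in> Obj C;
        f \<in> Arr C X Y; g \<in> Arr C Y Z; h \<in> Arr C Z W\<rbrakk>
      \<Longrightarrow> Comp C X Z W h (Comp C X Y Z g f) = Comp C X Y W (Comp C Y Z W h g) f"

record ('o, 'f, 'p, 'g) func =
  FObj :: "'o \<Rightarrow> 'p"
  FArr :: "'o \<Rightarrow> 'o \<Rightarrow> 'f \<Rightarrow> 'g"

locale is_functor = src: is_category C + tgt: is_category D
  for C :: "('o, 'f) cat" and D :: "('p, 'g) cat" +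
  fixes F :: "('o, 'f, 'p, 'g) func"
  assumes FObj_in: "X \<in> Obj C \<Longrightarrow> FObj F X \<in> Obj D"
    and FArr_in: "\<lbrakk>X \<in> Obj C; Y \<in> Obj C; f \<in> Arr C X Y\<rbrakk>
      \<Longrightarrow> FArr F X Y f \<in> Arr D (FObj F X) (FObj F Y)"
    and FArr_Ident: "X \<in> Obj C \<Longrightarrow> FArr F X X (Ident C X) = Ident D (FObj F X)"
    and FArr_Comp: "\<lbrakk>X \<in> Obj C; Y \<in> Obj C; Z \<in> Obj C; f \<in> Arr C X Y; g \<in> Arr C Y Z\<rbrakk>
      \<Longrightarrow> FArr F X Z (Comp C X Y Z g f)
        = Comp D (FObj F X) (FObj F Y) (FObj F Z) (FArr F Y Z g) (FArr F X Y f)"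

definition has_left_inverse :: "('o, 'f) cat \<Rightarrow> 'o \<Rightarrow> 'o \<Rightarrow> 'f \<Rightarrow> bool" where
  "has_left_inverse C X Y f \<longleftrightarrow> (\<exists>g \<in> Arr C Y X. Comp C X Y X g f = Ident C X)"

definition has_right_inverse :: "('o, 'f) cat \<Rightarrow> 'o \<Rightarrow> 'o \<Rightarrow> 'f \<Rightarrow> bool" where
  "has_right_inverse C X Y f \<longleftrightarrow> (\<exists>g \<in> Arr C Y X. Comp C Y X Y f g = Ident C Y)"

definition separable_functor ::
  "('o, 'f) cat \<Rightarrow> ('p, 'g) cat \<Rightarrow> ('o, 'f, 'p, 'g) func \<Rightarrow> bool" where
  "separable_functor C D F \<longleftrightarrow> (\<exists>P :: 'o \<Rightarrow> 'o \<Rightarrow> 'g \<Rightarrow> 'f.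
     (\<forall>X\<in>Obj C. \<forall>Y\<in>Obj C. \<forall>h\<in>Arr D (FObj F X) (FObj F Y). P X Y h \<in> Arr C X Y) \<and>
     (\<forall>X\<in>Obj C. \<forall>Y\<in>Obj C. \<forall>Z\<in>Obj C. \<forall>T\<in>Obj C.
       \<forall>u\<in>Arr C X Y. \<forall>v\<in>Arr C Z T. \<forall>h\<in>Arr D (FObj F Y) (FObj F Z).
         P X T (Comp D (FObj F X) (FObj F Z) (FObj F T) (FArr F Z T v)
                 (Comp D (FObj F X) (FObj F Y) (FObj F Z) h (FArr F X Y u)))
         = Comp C X Z T v (Comp C X Y Z (P Y Z h) u)) \<and>
     (\<forall>X\<in>Obj C. \<forall>Y\<in>Obj C. \<forall>f\<in>Arr C X Y. P X Y (FArr F X Y f) = f))"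

definition relative_injective ::
  "('o, 'f) cat \<Rightarrow> ('p, 'g) cat \<Rightarrow> ('o, 'f, 'p, 'g) func \<Rightarrow> 'o \<Rightarrow> bool" where
  "relative_injective C D F M \<longleftrightarrow>
     (\<forall>X\<in>Obj C. \<forall>Y\<in>Obj C. \<forall>i\<in>Arr C X Y.
        has_left_inverse D (FObj F X) (FObj F Y) (FArr F X Y i) \<longrightarrow>
        (\<forall>f\<in>Arr C X M. \<exists>g\<in>Arr C Y M. f = Comp C X Y M g i))"

definition maschke_functor ::
  "('o, 'f) cat \<Rightarrow> ('p, 'g) cat \<Rightarrow> ('o, 'f, 'p, 'g) func \<Rightarrow> bool" where
  "maschke_functor C D F \<longleftrightarrow> (\<forall>M\<in>Obj C. relative_injective C D F M)"

definition relative_projective ::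
  "('o, 'f) cat \<Rightarrow> ('p, 'g) cat \<Rightarrow> ('o, 'f, 'p, 'g) func \<Rightarrow> 'o \<Rightarrow> bool" where
  "relative_projective C D F P \<longleftrightarrow>
     (\<forall>Y\<in>Obj C. \<forall>X\<in>Obj C. \<forall>p\<in>Arr C Y X.
        has_right_inverse D (FObj F Y) (FObj F X) (FArr F Y X p) \<longrightarrow>
        (\<forall>f\<in>Arr C P X. \<exists>g\<in>Arr C P Y. f = Comp C P Y X p g))"

definition dual_maschke_functor ::
  "('o, 'f) cat \<Rightarrow> ('p, 'g) cat \<Rightarrow> ('o, 'f, 'p, 'g) func \<Rightarrow> bool" where
  "dual_maschke_functor C D F \<longleftrightarrow> (\<forall>P\<in>Obj C. relative_projective C D F P)"

definition zero_object :: "('o, 'f) cat \<Rightarrow> 'o \<Rightarrow> bool" where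
  "zero_object C Z \<longleftrightarrow> Z \<in> Obj C \<and> (\<forall>X\<in>Obj C. (\<exists>!f. f \<in> Arr C X Z) \<and> (\<exists>!f. f \<in> Arr C Z X))"

definition zero_arrow :: "('o, 'f) cat \<Rightarrow> 'o \<Rightarrow> 'o \<Rightarrow> 'f \<Rightarrow> bool" where
  "zero_arrow C X Y f \<longleftrightarrow>
     (\<exists>Z. zero_object C Z \<and> (\<exists>g\<in>Arr C X Z. \<exists>h\<in>Arr C Z Y. f = Comp C X Z Y h g))"

definition is_kernel :: "('o, 'f) cat \<Rightarrow> 'o \<Rightarrow> 'o \<Rightarrow> 'o \<Rightarrow> 'f \<Rightarrow> 'f \<Rightarrow> bool" where
  "is_kernel C X Y Z i p \<longleftrightarrow> zero_arrow C X Z (Comp C X Y Z p i) \<and>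
     (\<forall>T\<in>Obj C. \<forall>f\<in>Arr C T Y. zero_arrow C T Z (Comp C T Y Z p f) \<longrightarrow>
        (\<exists>!g. g \<in> Arr C T X \<and> Comp C T X Y i g = f))"

definition is_cokernel :: "('o, 'f) cat \<Rightarrow> 'o \<Rightarrow> 'o \<Rightarrow> 'o \<Rightarrow> 'f \<Rightarrow> 'f \<Rightarrow> bool" where
  "is_cokernel C X Y Z i p \<longleftrightarrow> zero_arrow C X Z (Comp C X Y Z p i) \<and>
     (\<forall>T\<in>Obj C. \<forall>f\<in>Arr C Y T. zero_arrow C X T (Comp C X Y T f i) \<longrightarrow>
        (\<exists>!g. g \<in> Arr C Z T \<and> Comp C Y Z T g p = f))"

text \<open>In an abelian category, \<open>0 \<rightarrow> X \<rightarrow> Y \<rightarrow> Z \<rightarrow> 0\<close> with arrows \<open>i\<close> and \<open>p\<close> is exact if and only if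
  \<open>i\<close> is a kernel of \<open>p\<close> and \<open>p\<close> is a cokernel of \<open>i\<close>.\<close>

definition short_exact :: "('o, 'f) cat \<Rightarrow> 'o \<Rightarrow> 'o \<Rightarrow> 'o \<Rightarrow> 'f \<Rightarrow> 'f \<Rightarrow> bool" where
  "short_exact C X Y Z i p \<longleftrightarrow>
     X \<in> Obj C \<and> Y \<in> Obj C \<and> Z \<in> Obj C \<and> i \<in> Arr C X Y \<and> p \<in> Arr C Y Z \<and>
     is_kernel C X Y Z i p \<and> is_cokernel C X Y Z i p"

definition split_exact :: "('o, 'f) cat \<Rightarrow> 'o \<Rightarrow> 'o \<Rightarrow> 'o \<Rightarrow> 'f \<Rightarrow> 'f \<Rightarrow> bool" where
  "split_exact C X Y Z i p \<longleftrightarrow> short_exact C X Y Z i p \<and> has_right_inverse C Y Z p"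

definition semisimple_functor ::
  "('o, 'f) cat \<Rightarrow> ('p, 'g) cat \<Rightarrow> ('o, 'f, 'p, 'g) func \<Rightarrow> bool" where
  "semisimple_functor C D F \<longleftrightarrow>
     (\<forall>X Y Z i p. short_exact C X Y Z i p \<and>
        split_exact D (FObj F X) (FObj F Y) (FObj F Z) (FArr F X Y i) (FArr F Y Z p) \<longrightarrow>
        split_exact C X Y Z i p)"


section \<open>Right modules and restriction of scalars\<close>

text \<open>A right module is stored in the \<open>module\<close> record of HOL-Algebra, with \<open>a \<odot>\<^bsub>M\<^esub> x\<close> standing for
  \<open>x \<cdot> a\<close>; the fields \<open>mult\<close> and \<open>one\<close> of the record are irrelevant.\<close>

locale right_module = R?: ring R + M?: abelian_group M
  for R (structure) and M :: "('a, 'b, 'm) module_scheme" (structure) +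
  assumes act_closed: "\<lbrakk>a \<in> carrier R; x \<in> carrier M\<rbrakk> \<Longrightarrow> a \<odot>\<^bsub>M\<^esub> x \<in> carrier M"
    and act_ring_distr: "\<lbrakk>a \<in> carrier R; b \<in> carrier R; x \<in> carrier M\<rbrakk>
      \<Longrightarrow> (a \<oplus>\<^bsub>R\<^esub> b) \<odot>\<^bsub>M\<^esub> x = a \<odot>\<^bsub>M\<^esub> x \<oplus>\<^bsub>M\<^esub> b \<odot>\<^bsub>M\<^esub> x"
    and act_distr: "\<lbrakk>a \<in> carrier R; x \<in> carrier M; y \<in> carrier M\<rbrakk>
      \<Longrightarrow> a \<odot>\<^bsub>M\<^esub> (x \<oplus>\<^bsub>M\<^esub> y) = a \<odot>\<^bsub>M\<^esub> x \<oplus>\<^bsub>M\<^esub> a \<odot>\<^bsub>M\<^esub> y"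
    and act_assoc: "\<lbrakk>a \<in> carrier R; b \<in> carrier R; x \<in> carrier M\<rbrakk>
      \<Longrightarrow> (a \<otimes>\<^bsub>R\<^esub> b) \<odot>\<^bsub>M\<^esub> x = b \<odot>\<^bsub>M\<^esub> (a \<odot>\<^bsub>M\<^esub> x)"
    and act_one: "x \<in> carrier M \<Longrightarrow> \<one>\<^bsub>R\<^esub> \<odot>\<^bsub>M\<^esub> x = x"

lemma right_module_iff_module:
  assumes "cring R"
  shows "right_module R M \<longleftrightarrow> module R M"
proof
  interpret cring R by fact
  show "module R M" if "right_module R M"
  proof -
    interpret right_module R M by fact
    show ?thesis
      by (rule moduleI)
        (use assms act_closed act_ring_distr act_distr act_assoc act_one m_comm
          in \<open>auto simp: M.abelian_group_axioms, metis\<close>)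
  qed
  show "right_module R M" if "module R M"
  proof -
    interpret module R M by fact
    show ?thesis
      by unfold_locales
        (auto simp: smult_l_distr smult_r_distr, metis m_comm smult_assoc1)
  qed
qed

text \<open>Homomorphisms are extensional, so that two of them are equal if and only if they agree on the
  carrier.\<close>

definition right_module_hom ::
  "('a, 'r) ring_scheme \<Rightarrow> ('a, 'b, 'm) module_scheme \<Rightarrow> ('a, 'c, 'n) module_scheme \<Rightarrow> ('b \<Rightarrow> 'c) set"
where
  "right_module_hom R M N = {f \<in> carrier M \<rightarrow>\<^sub>E carrier N.
     (\<forall>x\<in>carrier M. \<forall>y\<in>carrier M. f (x \<oplus>\<^bsub>M\<^esub> y) = f x \<oplus>\<^bsub>N\<^esub> f y) \<and>
     (\<forall>a\<in>carrier R. \<forall>x\<in>carrier M. f (a \<odot>\<^bsub>M\<^esub> x) = a \<odot>\<^bsub>N\<^esub> f x)}"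

text \<open>The category of right \<open>R\<close>-modules whose elements are taken from the type \<open>'u\<close>, which plays the
  role of a universe: a statement about all modules is a statement about all modules in \<open>'u\<close>, for an
  arbitrary \<open>'u\<close> that is large enough.\<close>

definition right_module_cat ::
  "('a, 'r) ring_scheme \<Rightarrow> (('a, 'u) module, 'u \<Rightarrow> 'u) cat" where
  "right_module_cat R =
     \<lparr>Obj = {M. right_module R M},
      Arr = right_module_hom R,
      Comp = (\<lambda>M N P g f. compose (carrier M) g f),
      Ident = (\<lambda>M. \<lambda>x\<in>carrier M. x)\<rparr>"

definition restrict_scalars_module ::
  "('k \<Rightarrow> 'h) \<Rightarrow> ('h, 'u) module \<Rightarrow> ('k, 'u) module" where
  "restrict_scalars_module \<phi> M =
     \<lparr>carrier = carrier M, monoid.mult = monoid.mult M, one = one M, ring.zero = \<zero>\<^bsub>M\<^esub>, add = add M,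
      smult = (\<lambda>r x. \<phi> r \<odot>\<^bsub>M\<^esub> x)\<rparr>"

definition restriction_of_scalars ::
  "('k \<Rightarrow> 'h) \<Rightarrow> (('h, 'u) module, 'u \<Rightarrow> 'u, ('k, 'u) module, 'u \<Rightarrow> 'u) func" where
  "restriction_of_scalars \<phi> = \<lparr>FObj = restrict_scalars_module \<phi>, FArr = (\<lambda>M N f. f)\<rparr>"

lemma is_category_right_module_cat: "is_category (right_module_cat R)"
  by unfold_locales
    (auto simp: right_module_cat_def right_module_hom_def compose_def PiE_def Pi_def extensional_def
      fun_eq_iff right_module.act_closed
      abelian_monoid.a_closed[OF abelian_group.axioms(1)[OF right_module.axioms(2)]])

lemma right_module_restrict_scalars:
  assumes "ring R" and \<phi>: "\<phi> \<in> ring_hom R S" and "right_module S M"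
  shows "right_module R (restrict_scalars_module \<phi> M)"
proof -
  interpret R: ring R by fact
  interpret right_module S M by fact
  have ab: "abelian_group (restrict_scalars_module \<phi> M)"
    by (rule abelian_groupI)
      (auto simp: restrict_scalars_module_def M.a_ac intro: exI[of _ "\<ominus>\<^bsub>M\<^esub> _"] M.l_neg)
  show ?thesis
    using ring_hom_closed[OF \<phi>] ring_hom_add[OF \<phi>] ring_hom_mult[OF \<phi>] ring_hom_one[OF \<phi>]
    by (intro right_module.intro ab \<open>ring R\<close> right_module_axioms.intro)
      (auto simp: restrict_scalars_module_def act_closed act_ring_distr act_distr act_assoc act_one)
qed

lemma is_functor_restriction_of_scalars:
  assumes "ring R" and \<phi>: "\<phi> \<in> ring_hom R S"
  shows "is_functor (right_module_cat S) (right_module_cat R) (restriction_of_scalars \<phi>)"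
  using right_module_restrict_scalars[OF assms] ring_hom_closed[OF \<phi>]
  by (intro is_functor.intro is_category_right_module_cat is_functor_axioms.intro)
    (auto simp: right_module_cat_def restriction_of_scalars_def restrict_scalars_module_def
       right_module_hom_def)


section \<open>Tensor products over a commutative ring\<close>

text \<open>The tensor product of \<open>M\<close> and \<open>N\<close> over \<open>k\<close> is the free abelian group on
  \<open>carrier M \<times> carrier N\<close> modulo the subgroup generated by the usual relations. Its product
  \<open>(a \<otimes> b) (c \<otimes> d) = a c \<otimes> b d\<close> and unit \<open>1 \<otimes> 1\<close> are meaningful only if \<open>M\<close> and \<open>N\<close> are algebras.\<close>

definition tensor_relations ::
  "('k, 'r) ring_scheme \<Rightarrow> ('k, 'a, 'm) module_scheme \<Rightarrow> ('k, 'b, 'n) module_scheme \<Rightarrow>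
   ('a \<times> 'b \<Rightarrow>\<^sub>0 int) set" where
  "tensor_relations k M N =
     {frag_of (a \<oplus>\<^bsub>M\<^esub> a', b) - (frag_of (a, b) + frag_of (a', b)) | a a' b.
        a \<in> carrier M \<and> a' \<in> carrier M \<and> b \<in> carrier N} \<union>
     {frag_of (a, b \<oplus>\<^bsub>N\<^esub> b') - (frag_of (a, b) + frag_of (a, b')) | a b b'.
        a \<in> carrier M \<and> b \<in> carrier N \<and> b' \<in> carrier N} \<union>
     {frag_of (r \<odot>\<^bsub>M\<^esub> a, b) - frag_of (a, r \<odot>\<^bsub>N\<^esub> b) | r a b.
        r \<in> carrier k \<and> a \<in> carrier M \<and> b \<in> carrier N}"

definition tensor_free ::
  "('k, 'a, 'm) module_scheme \<Rightarrow> ('k, 'b, 'n) module_scheme \<Rightarrow> ('a \<times> 'b \<Rightarrow>\<^sub>0 int) monoid" where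
  "tensor_free M N = free_Abelian_group (carrier M \<times> carrier N)"

definition tensor_null ::
  "('k, 'r) ring_scheme \<Rightarrow> ('k, 'a, 'm) module_scheme \<Rightarrow> ('k, 'b, 'n) module_scheme \<Rightarrow>
   ('a \<times> 'b \<Rightarrow>\<^sub>0 int) set" where
  "tensor_null k M N = generate (tensor_free M N) (tensor_relations k M N)"

definition tensor_class ::
  "('k, 'r) ring_scheme \<Rightarrow> ('k, 'a, 'm) module_scheme \<Rightarrow> ('k, 'b, 'n) module_scheme \<Rightarrow>
   ('a \<times> 'b \<Rightarrow>\<^sub>0 int) \<Rightarrow> ('a \<times> 'b \<Rightarrow>\<^sub>0 int) set" where
  "tensor_class k M N x = tensor_null k M N #>\<^bsub>tensor_free M N\<^esub> x"

definition pure_tensor ::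
  "('k, 'r) ring_scheme \<Rightarrow> ('k, 'a, 'm) module_scheme \<Rightarrow> ('k, 'b, 'n) module_scheme \<Rightarrow>
   'a \<Rightarrow> 'b \<Rightarrow> ('a \<times> 'b \<Rightarrow>\<^sub>0 int) set" where
  "pure_tensor k M N a b = tensor_class k M N (frag_of (a, b))"

definition representative :: "'c set \<Rightarrow> 'c" where
  "representative X = (SOME x. x \<in> X)"

definition tensor_product ::
  "('k, 'r) ring_scheme \<Rightarrow> ('k, 'a, 'm) module_scheme \<Rightarrow> ('k, 'b, 'n) module_scheme \<Rightarrow>
   ('k, ('a \<times> 'b \<Rightarrow>\<^sub>0 int) set) module" where
  "tensor_product k M N =
     \<lparr>carrier = carrier (tensor_free M N Mod tensor_null k M N),
      monoid.mult = (\<lambda>X Y. tensor_class k M N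
        (frag_extend (\<lambda>(a, b). frag_extend (\<lambda>(c, d). frag_of (a \<otimes>\<^bsub>M\<^esub> c, b \<otimes>\<^bsub>N\<^esub> d)) (representative Y))
          (representative X))),
      one = pure_tensor k M N \<one>\<^bsub>M\<^esub> \<one>\<^bsub>N\<^esub>,
      ring.zero = \<one>\<^bsub>tensor_free M N Mod tensor_null k M N\<^esub>,
      add = monoid.mult (tensor_free M N Mod tensor_null k M N),
      smult = (\<lambda>r X. tensor_class k M N
        (frag_extend (\<lambda>(a, b). frag_of (r \<odot>\<^bsub>M\<^esub> a, b)) (representative X)))\<rparr>"

text \<open>For a \<open>k\<close>-balanced biadditive map \<open>\<beta>\<close> into an abelian group \<open>P\<close>, this is the induced map on the
  tensor product: it sends the class of \<open>\<Sum> n\<^sub>i (a\<^sub>i, b\<^sub>i)\<close> to \<open>\<Sum> n\<^sub>i \<beta> a\<^sub>i b\<^sub>i\<close>; see the lemmas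
  below.\<close>

definition tensor_lift ::
  "('c, 'p) ring_scheme \<Rightarrow> ('a \<Rightarrow> 'b \<Rightarrow> 'c) \<Rightarrow> ('a \<times> 'b \<Rightarrow>\<^sub>0 int) set \<Rightarrow> 'c" where
  "tensor_lift P \<beta> X = (let x = representative X in
     \<Oplus>\<^bsub>P\<^esub>c\<in>Poly_Mapping.keys x. [Poly_Mapping.lookup x c] \<cdot>\<^bsub>P\<^esub> \<beta> (fst c) (snd c))"


definition balanced ::
  "('k, 'r) ring_scheme \<Rightarrow> ('k, 'a, 'm) module_scheme \<Rightarrow> ('k, 'b, 'n) module_scheme \<Rightarrow>
   ('c, 'p) ring_scheme \<Rightarrow> ('a \<Rightarrow> 'b \<Rightarrow> 'c) \<Rightarrow> bool" where
  "balanced k M N P \<beta> \<longleftrightarrow>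
     (\<forall>a\<in>carrier M. \<forall>b\<in>carrier N. \<beta> a b \<in> carrier P) \<and>
     (\<forall>a\<in>carrier M. \<forall>a'\<in>carrier M. \<forall>b\<in>carrier N. \<beta> (a \<oplus>\<^bsub>M\<^esub> a') b = \<beta> a b \<oplus>\<^bsub>P\<^esub> \<beta> a' b) \<and>
     (\<forall>a\<in>carrier M. \<forall>b\<in>carrier N. \<forall>b'\<in>carrier N. \<beta> a (b \<oplus>\<^bsub>N\<^esub> b') = \<beta> a b \<oplus>\<^bsub>P\<^esub> \<beta> a b') \<and>
     (\<forall>r\<in>carrier k. \<forall>a\<in>carrier M. \<forall>b\<in>carrier N. \<beta> (r \<odot>\<^bsub>M\<^esub> a) b = \<beta> a (r \<odot>\<^bsub>N\<^esub> b))"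

lemma comm_group_tensor_free: "comm_group (tensor_free M N)"
  by (simp add: tensor_free_def abelian_free_Abelian_group)

lemma carrier_tensor_free: "x \<in> carrier (tensor_free M N) \<longleftrightarrow> Poly_Mapping.keys x \<subseteq> carrier M \<times> carrier N"
  by (simp add: tensor_free_def)

lemma mult_tensor_free [simp]: "x \<otimes>\<^bsub>tensor_free M N\<^esub> y = x + y"
  and one_tensor_free [simp]: "\<one>\<^bsub>tensor_free M N\<^esub> = 0"
  by (simp_all add: tensor_free_def)

lemma tensor_relations_in:
  assumes "module k M" "module k N"
  shows "tensor_relations k M N \<subseteq> carrier (tensor_free M N)"
proof -
  interpret M: module k M by fact
  interpret N: module k N by fact
  interpret F: comm_group "tensor_free M N" by (rule comm_group_tensor_free)
  have of: "frag_of (a, b) \<in> carrier (tensor_free M N)" if "a \<in> carrier M" "b \<in> carrier N" for a b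
    using that by (simp add: carrier_tensor_free)
  have plus: "x + y \<in> carrier (tensor_free M N)"
    if "x \<in> carrier (tensor_free M N)" "y \<in> carrier (tensor_free M N)" for x y
    using F.m_closed[OF that] by simp
  have minus: "x - y \<in> carrier (tensor_free M N)"
    if "x \<in> carrier (tensor_free M N)" "y \<in> carrier (tensor_free M N)" for x y
    using that keys_diff[of x y] by (auto simp: carrier_tensor_free)
  show ?thesis
    unfolding tensor_relations_def
    by (auto intro!: of plus minus)
qed

lemma subgroup_tensor_null:
  assumes "module k M" "module k N"
  shows "subgroup (tensor_null k M N) (tensor_free M N)"
proof -
  interpret F: comm_group "tensor_free M N" by (rule comm_group_tensor_free)
  show ?thesis
    unfolding tensor_null_def by (rule F.generate_is_subgroup[OF tensor_relations_in[OF assms]])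
qed

lemma abelian_group_tensor_product:
  assumes "module k M" "module k N"
  shows "abelian_group (tensor_product k M N)"
proof -
  interpret F: comm_group "tensor_free M N" by (rule comm_group_tensor_free)
  have "comm_group (tensor_free M N Mod tensor_null k M N)"
    by (rule F.abelian_FactGroup[OF subgroup_tensor_null[OF assms]])
  then interpret Q: comm_group "tensor_free M N Mod tensor_null k M N" .
  let ?T = "tensor_product k M N"
  have T: "carrier ?T = carrier (tensor_free M N Mod tensor_null k M N)"
    "add ?T = monoid.mult (tensor_free M N Mod tensor_null k M N)"
    "\<zero>\<^bsub>?T\<^esub> = \<one>\<^bsub>tensor_free M N Mod tensor_null k M N\<^esub>"
    by (simp_all add: tensor_product_def)
  show ?thesis
    by (rule abelian_groupI; unfold T)
      (use Q.m_closed Q.one_closed Q.l_one Q.m_assoc Q.m_comm Q.l_inv_ex in auto)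
qed

lemma (in abelian_group) frag_sum_hom:
  fixes S :: "'c set"
  assumes "\<beta> \<in> S \<rightarrow> carrier G"
  shows "(\<lambda>x. \<Oplus>c\<in>Poly_Mapping.keys x. [Poly_Mapping.lookup x c] \<cdot> \<beta> c)
           \<in> hom (free_Abelian_group S) (add_monoid G)"
proof (rule homI)
  fix x :: "'c \<Rightarrow>\<^sub>0 int" assume "x \<in> carrier (free_Abelian_group S)"
  then show "(\<Oplus>c\<in>Poly_Mapping.keys x. [Poly_Mapping.lookup x c] \<cdot> \<beta> c) \<in> carrier (add_monoid G)"
    using assms by (auto intro!: finsum_closed)
next
  fix x y :: "'c \<Rightarrow>\<^sub>0 int"
  assume xy: "x \<in> carrier (free_Abelian_group S)" "y \<in> carrier (free_Abelian_group S)"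
  let ?T = "Poly_Mapping.keys x \<union> Poly_Mapping.keys y"
  have T: "\<beta> c \<in> carrier G" if "c \<in> ?T" for c
    using that xy assms by auto
  have 0: "[(0::int)] \<cdot> a = \<zero>" for a
    by (simp add: add_pow_def int_pow_def)
  have ext: "(\<Oplus>c\<in>Poly_Mapping.keys z. [Poly_Mapping.lookup z c] \<cdot> \<beta> c)
      = (\<Oplus>c\<in>?T. [Poly_Mapping.lookup z c] \<cdot> \<beta> c)" if "Poly_Mapping.keys z \<subseteq> ?T"
      for z :: "'c \<Rightarrow>\<^sub>0 int"
    using that T
    by (intro add.finprod_mono_neutral_cong_left)
      (auto simp: in_keys_iff 0 Pi_def intro!: add.int_pow_closed)
  have "(\<Oplus>c\<in>?T. [Poly_Mapping.lookup (x + y) c] \<cdot> \<beta> c)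
      = (\<Oplus>c\<in>?T. [Poly_Mapping.lookup x c] \<cdot> \<beta> c \<oplus> [Poly_Mapping.lookup y c] \<cdot> \<beta> c)"
    using T by (intro add.finprod_cong') (auto simp: lookup_add add.int_pow_mult)
  also have "\<dots> = (\<Oplus>c\<in>?T. [Poly_Mapping.lookup x c] \<cdot> \<beta> c) \<oplus> (\<Oplus>c\<in>?T. [Poly_Mapping.lookup y c] \<cdot> \<beta> c)"
    using T by (intro finsum_addf) auto
  finally show "(\<Oplus>c\<in>Poly_Mapping.keys (x \<otimes>\<^bsub>free_Abelian_group S\<^esub> y).
          [Poly_Mapping.lookup (x \<otimes>\<^bsub>free_Abelian_group S\<^esub> y) c] \<cdot> \<beta> c)
    = (\<Oplus>c\<in>Poly_Mapping.keys x. [Poly_Mapping.lookup x c] \<cdot> \<beta> c) \<otimes>\<^bsub>add_monoid G\<^esub>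
      (\<Oplus>c\<in>Poly_Mapping.keys y. [Poly_Mapping.lookup y c] \<cdot> \<beta> c)"
    using ext[OF Poly_Mapping.keys_add] ext[of x] ext[of y] by simp
qed

lemma tensor_lift_class:
  fixes M :: "('k, 'b, 'm) module_scheme" and N :: "('k, 'e, 'n) module_scheme"
  assumes M: "module k M" and N: "module k N" and P: "abelian_group P"
    and bal: "balanced k M N P \<beta>"
    and x: "Poly_Mapping.keys x \<subseteq> carrier M \<times> carrier N"
  shows "tensor_lift P \<beta> (tensor_class k M N x) =
    (\<Oplus>\<^bsub>P\<^esub>c\<in>Poly_Mapping.keys x. [Poly_Mapping.lookup x c] \<cdot>\<^bsub>P\<^esub> \<beta> (fst c) (snd c))"
proof -
  interpret M: module k M by fact
  interpret N: module k N by fact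
  interpret P: abelian_group P by fact
  interpret F: comm_group "tensor_free M N" by (rule comm_group_tensor_free)
  let ?S = "carrier M \<times> carrier N"
  define \<phi> where "\<phi> x = (\<Oplus>\<^bsub>P\<^esub>c\<in>Poly_Mapping.keys x. [Poly_Mapping.lookup x c] \<cdot>\<^bsub>P\<^esub> \<beta> (fst c) (snd c))"
    for x :: "'b \<times> 'e \<Rightarrow>\<^sub>0 int"
  have hom: "\<phi> \<in> hom (tensor_free M N) (add_monoid P)"
    unfolding \<phi>_def tensor_free_def
    using bal by (intro P.frag_sum_hom) (auto simp: balanced_def)
  interpret \<phi>: group_hom "tensor_free M N" "add_monoid P" \<phi>
    by (intro group_hom.intro group_hom_axioms.intro hom F.group_axioms P.add.group_axioms)
  have of: "\<phi> (frag_of (a, b)) = \<beta> a b" if "a \<in> carrier M" "b \<in> carrier N" for a b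
    using that bal by (simp add: \<phi>_def balanced_def)
  have of_in: "frag_of (a, b) \<in> carrier (tensor_free M N)" if "a \<in> carrier M" "b \<in> carrier N" for a b
    using that by (simp add: carrier_tensor_free)
  have plus: "x + y \<in> carrier (tensor_free M N)" "\<phi> (x + y) = \<phi> x \<oplus>\<^bsub>P\<^esub> \<phi> y"
    if "x \<in> carrier (tensor_free M N)" "y \<in> carrier (tensor_free M N)" for x y
    using F.m_closed[OF that] \<phi>.hom_mult[OF that] by simp_all
  have minus: "\<phi> (x - y) = \<zero>\<^bsub>P\<^esub>"
    if "x \<in> carrier (tensor_free M N)" "y \<in> carrier (tensor_free M N)" "\<phi> x = \<phi> y" for x y
  proof -
    have "x - y \<in> carrier (tensor_free M N)"
      using that keys_diff[of x y] by (auto simp: carrier_tensor_free)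
    then have "\<phi> x = \<phi> (x - y) \<oplus>\<^bsub>P\<^esub> \<phi> y" "\<phi> (x - y) \<in> carrier P"
      using plus(2)[of "x - y" y] that \<phi>.hom_closed by auto
    then show ?thesis
      using that \<phi>.hom_closed[of y] P.add.r_cancel_one[of "\<phi> y" "\<phi> (x - y)"] by simp
  qed
  have "tensor_relations k M N \<subseteq> kernel (tensor_free M N) (add_monoid P) \<phi>"
  proof
    fix r assume r: "r \<in> tensor_relations k M N"
    then have "\<phi> r = \<zero>\<^bsub>P\<^esub>"
      using bal
      by (auto simp: tensor_relations_def plus of of_in balanced_def intro!: minus)
    with r show "r \<in> kernel (tensor_free M N) (add_monoid P) \<phi>"
      using tensor_relations_in[OF M N] by (auto simp: kernel_def)
  qed
  then have null: "tensor_null k M N \<subseteq> kernel (tensor_free M N) (add_monoid P) \<phi>"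
    unfolding tensor_null_def by (rule F.generate_subgroup_incl[OF _ \<phi>.subgroup_kernel])
  have xin: "x \<in> carrier (tensor_free M N)"
    using x by (simp add: carrier_tensor_free)
  have eq: "\<phi> y = \<phi> x" if "y \<in> tensor_class k M N x" for y
    using that null xin \<phi>.hom_closed[OF xin] plus(2)
    by (auto simp: tensor_class_def r_coset_def kernel_def)
  have "x \<in> tensor_class k M N x"
    unfolding tensor_class_def by (rule F.rcos_self[OF xin subgroup_tensor_null[OF M N]])
  then have "representative (tensor_class k M N x) \<in> tensor_class k M N x"
    unfolding representative_def by (rule someI)
  from eq[OF this] show ?thesis
    by (simp add: tensor_lift_def Let_def \<phi>_def)
qed

lemma tensor_lift_pure:
  assumes "module k M" "module k N" "abelian_group P" "balanced k M N P \<beta>"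
    and "a \<in> carrier M" "b \<in> carrier N"
  shows "tensor_lift P \<beta> (pure_tensor k M N a b) = \<beta> a b"
proof -
  interpret P: abelian_group P by fact
  have "\<beta> a b \<in> carrier P"
    using assms(4-6) unfolding balanced_def by blast
  then have "(\<Oplus>\<^bsub>P\<^esub>c\<in>{(a, b)}. [Poly_Mapping.lookup (frag_of (a, b)) c] \<cdot>\<^bsub>P\<^esub> \<beta> (fst c) (snd c)) = \<beta> a b"
    by simp
  moreover have "Poly_Mapping.keys (frag_of (a, b)) = {(a, b)}"
    by simp
  ultimately show ?thesis
    using tensor_lift_class[OF assms(1-4), of "frag_of (a, b)"] assms(5,6)
    unfolding pure_tensor_def by simp
qed

lemma tensor_lift_add:
  assumes M: "module k M" and N: "module k N" and P: "abelian_group P"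
    and bal: "balanced k M N P \<beta>"
    and X: "U \<in> carrier (tensor_product k M N)" "V \<in> carrier (tensor_product k M N)"
  shows "tensor_lift P \<beta> (U \<oplus>\<^bsub>tensor_product k M N\<^esub> V) = tensor_lift P \<beta> U \<oplus>\<^bsub>P\<^esub> tensor_lift P \<beta> V"
proof -
  interpret P: abelian_group P by fact
  interpret F: comm_group "tensor_free M N" by (rule comm_group_tensor_free)
  have nrm: "tensor_null k M N \<lhd> tensor_free M N"
    by (rule F.subgroup_imp_normal[OF subgroup_tensor_null[OF M N]])
  obtain x y where x: "x \<in> carrier (tensor_free M N)" "U = tensor_class k M N x"
    and y: "y \<in> carrier (tensor_free M N)" "V = tensor_class k M N y"
    using X by (auto simp: tensor_product_def carrier_FactGroup tensor_class_def)
  have UV: "U \<oplus>\<^bsub>tensor_product k M N\<^esub> V = tensor_class k M N (x + y)"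
    using normal.rcos_sum[OF nrm x(1) y(1)]
    by (simp add: x(2) y(2) tensor_product_def tensor_class_def)
  have xy: "x + y \<in> carrier (tensor_free M N)"
    using F.m_closed[OF x(1) y(1)] by simp
  have "(\<lambda>c. \<beta> (fst c) (snd c)) \<in> carrier M \<times> carrier N \<rightarrow> carrier P"
    using bal by (auto simp: balanced_def)
  from hom_mult[OF P.frag_sum_hom[OF this], of x y] x(1) y(1)
  have "tensor_lift P \<beta> (tensor_class k M N (x + y))
      = tensor_lift P \<beta> (tensor_class k M N x) \<oplus>\<^bsub>P\<^esub> tensor_lift P \<beta> (tensor_class k M N y)"
    using tensor_lift_class[OF M N P bal] x(1) y(1) xy
    by (simp add: carrier_tensor_free tensor_free_def)
  then show ?thesis
    unfolding UV by (simp only: x(2) y(2))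
qed


section \<open>Hopf algebras\<close>

locale assoc_algebra = module k H + H: ring H
  for k (structure) and H (structure) +
  assumes smult_mult_left: "\<lbrakk>r \<in> carrier k; x \<in> carrier H; y \<in> carrier H\<rbrakk>
      \<Longrightarrow> (r \<odot>\<^bsub>H\<^esub> x) \<otimes>\<^bsub>H\<^esub> y = r \<odot>\<^bsub>H\<^esub> (x \<otimes>\<^bsub>H\<^esub> y)"
    and smult_mult_right: "\<lbrakk>r \<in> carrier k; x \<in> carrier H; y \<in> carrier H\<rbrakk>
      \<Longrightarrow> x \<otimes>\<^bsub>H\<^esub> (r \<odot>\<^bsub>H\<^esub> y) = r \<odot>\<^bsub>H\<^esub> (x \<otimes>\<^bsub>H\<^esub> y)"

definition algebra_unit :: "('k, 'h, 'm) module_scheme \<Rightarrow> 'k \<Rightarrow> 'h" where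
  "algebra_unit H r = r \<odot>\<^bsub>H\<^esub> \<one>\<^bsub>H\<^esub>"

lemma (in assoc_algebra) algebra_unit_hom: "algebra_unit H \<in> ring_hom k H"
  by (rule ring_hom_memI)
    (auto simp: algebra_unit_def smult_l_distr smult_assoc1 smult_mult_left)

text \<open>\<open>\<Delta>\<close> is the comultiplication, \<open>\<epsilon>\<close> the counit and \<open>S\<close> the antipode. Writing
  \<open>\<Delta> h = \<Sum> h\<^sub>1 \<otimes> h\<^sub>2\<close>, \<open>coassoc\<close> is the identity
  \<open>\<Sum> h\<^sub>1\<^sub>1 \<otimes> (h\<^sub>1\<^sub>2 \<otimes> h\<^sub>2) = \<Sum> h\<^sub>1 \<otimes> \<Delta> h\<^sub>2\<close>.\<close>

locale hopf_algebra = assoc_algebra k H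
  for k (structure) and H (structure) +
  fixes \<Delta> :: "'b \<Rightarrow> ('b \<times> 'b \<Rightarrow>\<^sub>0 int) set" and \<epsilon> :: "'b \<Rightarrow> 'a" and S :: "'b \<Rightarrow> 'b"
  assumes \<Delta>_hom: "\<Delta> \<in> ring_hom H (tensor_product k H H)"
    and \<Delta>_smult: "\<lbrakk>r \<in> carrier k; h \<in> carrier H\<rbrakk>
      \<Longrightarrow> \<Delta> (r \<odot>\<^bsub>H\<^esub> h) = r \<odot>\<^bsub>tensor_product k H H\<^esub> \<Delta> h"
    and \<epsilon>_hom: "\<epsilon> \<in> ring_hom H k"
    and \<epsilon>_smult: "\<lbrakk>r \<in> carrier k; h \<in> carrier H\<rbrakk> \<Longrightarrow> \<epsilon> (r \<odot>\<^bsub>H\<^esub> h) = r \<otimes>\<^bsub>k\<^esub> \<epsilon> h"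
    and coassoc: "h \<in> carrier H \<Longrightarrow>
      tensor_lift (tensor_product k H (tensor_product k H H))
        (\<lambda>a b. tensor_lift (tensor_product k H (tensor_product k H H))
          (\<lambda>c d. pure_tensor k H (tensor_product k H H) c (pure_tensor k H H d b)) (\<Delta> a)) (\<Delta> h)
      = tensor_lift (tensor_product k H (tensor_product k H H))
        (\<lambda>a b. pure_tensor k H (tensor_product k H H) a (\<Delta> b)) (\<Delta> h)"
    and counit_left: "h \<in> carrier H \<Longrightarrow> tensor_lift H (\<lambda>a b. \<epsilon> a \<odot>\<^bsub>H\<^esub> b) (\<Delta> h) = h"
    and counit_right: "h \<in> carrier H \<Longrightarrow> tensor_lift H (\<lambda>a b. \<epsilon> b \<odot>\<^bsub>H\<^esub> a) (\<Delta> h) = h"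
    and S_closed: "h \<in> carrier H \<Longrightarrow> S h \<in> carrier H"
    and S_add: "\<lbrakk>g \<in> carrier H; h \<in> carrier H\<rbrakk> \<Longrightarrow> S (g \<oplus>\<^bsub>H\<^esub> h) = S g \<oplus>\<^bsub>H\<^esub> S h"
    and S_smult: "\<lbrakk>r \<in> carrier k; h \<in> carrier H\<rbrakk> \<Longrightarrow> S (r \<odot>\<^bsub>H\<^esub> h) = r \<odot>\<^bsub>H\<^esub> S h"
    and antipode_left: "h \<in> carrier H \<Longrightarrow>
      tensor_lift H (\<lambda>a b. S a \<otimes>\<^bsub>H\<^esub> b) (\<Delta> h) = \<epsilon> h \<odot>\<^bsub>H\<^esub> \<one>\<^bsub>H\<^esub>"
    and antipode_right: "h \<in> carrier H \<Longrightarrow>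
      tensor_lift H (\<lambda>a b. a \<otimes>\<^bsub>H\<^esub> S b) (\<Delta> h) = \<epsilon> h \<odot>\<^bsub>H\<^esub> \<one>\<^bsub>H\<^esub>"

definition right_integral ::
  "('k, 'h, 'm) module_scheme \<Rightarrow> ('h \<Rightarrow> 'k) \<Rightarrow> 'h \<Rightarrow> bool" where
  "right_integral H \<epsilon> t \<longleftrightarrow>
     t \<in> carrier H \<and> (\<forall>h\<in>carrier H. t \<otimes>\<^bsub>H\<^esub> h = \<epsilon> h \<odot>\<^bsub>H\<^esub> t)"

end

theory Submission
  imports Defs "HOL-Algebra.RingHom"
begin

text \<open>
  A right integral \<open>t\<close> with \<open>\<epsilon> t = 1\<close> is an averaging device. For a \<open>k\<close>-linear map \<open>h : M \<rightarrow> N\<close>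
  between right \<open>H\<close>-modules put \<open>(\<P> h) m = \<Sum> h (m S(t\<^sub>1)) t\<^sub>2\<close>. It is \<open>H\<close>-linear because of the
  identity \<open>\<Sum> a S(t\<^sub>1) \<otimes> t\<^sub>2 = \<Sum> S(t\<^sub>1) \<otimes> t\<^sub>2 a\<close> (lemma \<open>integral_casimir\<close>), it is visibly natural, and it
  fixes \<open>H\<close>-linear maps because \<open>\<Sum> S(t\<^sub>1) t\<^sub>2 = \<epsilon>(t) 1\<close>. So restriction of scalars is separable. In
  any categories, separability implies both Maschke properties: apply \<open>\<P>\<close> to the given one-sided
  inverse. The dual Maschke property for the identity of the quotient term implies semisimplicity.

  Conversely, all the information sits in one sequence of right \<open>H\<close>-modules,
  \<open>0 \<rightarrow> ker \<epsilon> \<rightarrow> H \<rightarrow> k \<rightarrow> 0\<close>, with \<open>H\<close> acting on \<open>k\<close> through \<open>\<epsilon>\<close>. The unit of \<open>H\<close> splits it over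
  \<open>k\<close>. If \<open>s\<close> is an \<open>H\<close>-linear section of \<open>\<epsilon>\<close>, then \<open>s 1\<close> is an integral of counit one; if \<open>g\<close> is an
  \<open>H\<close>-linear retraction onto \<open>ker \<epsilon>\<close>, then \<open>1 - g 1\<close> is one. Semisimplicity provides a section, and
  the Maschke property, for the identity of \<open>ker \<epsilon>\<close>, provides a retraction. The implications thus
  close up as integral \<open>\<Rightarrow>\<close> separable \<open>\<Rightarrow>\<close> dual Maschke \<open>\<Rightarrow>\<close> semisimple \<open>\<Rightarrow>\<close> integral and
  separable \<open>\<Rightarrow>\<close> Maschke \<open>\<Rightarrow>\<close> integral.

  Two technical layers support this. Sigma notation is made rigorous by reading \<open>\<Sum> \<beta> h\<^sub>1 h\<^sub>2\<close> as the
  map induced by \<open>\<beta>\<close> on the tensor product, evaluated at \<open>\<Delta> h\<close>; the Hopf algebra axioms become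
  rewrite rules for such sums. And the three modules of the sequence are copied into the universe
  \<open>'u\<close> along one injection of \<open>H\<close>; the ring \<open>k\<close> fits as well, since \<open>\<epsilon>\<close> is a left inverse of the unit.
\<close>

section \<open>Integer combinations in an abelian group\<close>

text \<open>The homomorphism from the free abelian group that extends \<open>\<beta>\<close>. The map induced on a tensor product by
  a balanced map is defined by this sum over a chosen representative.\<close>

definition frag_sum :: "('a, 'm) ring_scheme \<Rightarrow> ('c \<Rightarrow> 'a) \<Rightarrow> ('c \<Rightarrow>\<^sub>0 int) \<Rightarrow> 'a" where
  "frag_sum P \<beta> x = (\<Oplus>\<^bsub>P\<^esub>c\<in>Poly_Mapping.keys x. [Poly_Mapping.lookup x c] \<cdot>\<^bsub>P\<^esub> \<beta> c)"

context abelian_group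
begin

lemma frag_sum_group_hom:
  assumes "\<beta> \<in> S \<rightarrow> carrier G"
  shows "group_hom (free_Abelian_group S) (add_monoid G) (frag_sum G \<beta>)"
  using frag_sum_hom[OF assms]
  by (intro group_hom.intro group_hom_axioms.intro) (simp_all add: frag_sum_def[abs_def] add.group_axioms)

lemma frag_sum_closed:
  assumes "\<beta> \<in> S \<rightarrow> carrier G" "Poly_Mapping.keys x \<subseteq> S"
  shows "frag_sum G \<beta> x \<in> carrier G"
  using group_hom.hom_closed[OF frag_sum_group_hom[OF assms(1)]] assms(2) by simp

lemma frag_sum_zero: "frag_sum G \<beta> 0 = \<zero>"
  by (simp add: frag_sum_def)

lemma frag_sum_of:
  assumes "\<beta> c \<in> carrier G"
  shows "frag_sum G \<beta> (frag_of c) = \<beta> c"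
  using assms by (simp add: frag_sum_def)

lemma frag_sum_diff:
  assumes \<beta>: "\<beta> \<in> S \<rightarrow> carrier G"
    and x: "Poly_Mapping.keys x \<subseteq> S" and y: "Poly_Mapping.keys y \<subseteq> S"
  shows "frag_sum G \<beta> (x - y) = frag_sum G \<beta> x \<ominus> frag_sum G \<beta> y"
proof -
  interpret h: group_hom "free_Abelian_group S" "add_monoid G" "frag_sum G \<beta>"
    by (rule frag_sum_group_hom[OF \<beta>])
  have "frag_sum G \<beta> (x + - y) = frag_sum G \<beta> x \<oplus> frag_sum G \<beta> (- y)"
    using h.hom_mult[of x "- y"] x y by simp
  moreover have "frag_sum G \<beta> (- y) = \<ominus> frag_sum G \<beta> y"
    using h.hom_inv[of y] y by (simp add: a_inv_def)
  ultimately show ?thesis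
    by (simp add: minus_eq)
qed

lemma frag_sum_cong:
  assumes "Poly_Mapping.keys x \<subseteq> S" "\<And>c. c \<in> S \<Longrightarrow> \<beta> c = \<gamma> c"
    and "\<gamma> \<in> S \<rightarrow> carrier G"
  shows "frag_sum G \<beta> x = frag_sum G \<gamma> x"
  unfolding frag_sum_def
  using assms by (intro add.finprod_cong') (auto intro!: add.int_pow_closed)

lemma frag_sum_add:
  assumes x: "Poly_Mapping.keys x \<subseteq> S" and \<beta>: "\<beta> \<in> S \<rightarrow> carrier G" and \<gamma>: "\<gamma> \<in> S \<rightarrow> carrier G"
  shows "frag_sum G (\<lambda>c. \<beta> c \<oplus> \<gamma> c) x = frag_sum G \<beta> x \<oplus> frag_sum G \<gamma> x"
proof -
  have \<beta>': "\<And>c. c \<in> Poly_Mapping.keys x \<Longrightarrow> \<beta> c \<in> carrier G"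
    and \<gamma>': "\<And>c. c \<in> Poly_Mapping.keys x \<Longrightarrow> \<gamma> c \<in> carrier G"
    using assms by auto
  have "frag_sum G (\<lambda>c. \<beta> c \<oplus> \<gamma> c) x = (\<Oplus>c\<in>Poly_Mapping.keys x.
     [Poly_Mapping.lookup x c] \<cdot> \<beta> c \<oplus> [Poly_Mapping.lookup x c] \<cdot> \<gamma> c)"
    unfolding frag_sum_def using \<beta>' \<gamma>'
    by (intro add.finprod_cong') (auto simp: add.int_pow_distrib)
  also have "\<dots> = frag_sum G \<beta> x \<oplus> frag_sum G \<gamma> x"
    unfolding frag_sum_def using \<beta>' \<gamma>' by (intro finsum_addf) auto
  finally show ?thesis .
qed

end

lemma additive_minus:
  assumes P: "abelian_group P" and Q: "abelian_group Q"
    and f: "f \<in> carrier P \<rightarrow> carrier Q"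
    and add: "\<And>x y. x \<in> carrier P \<Longrightarrow> y \<in> carrier P \<Longrightarrow> f (x \<oplus>\<^bsub>P\<^esub> y) = f x \<oplus>\<^bsub>Q\<^esub> f y"
  shows "f \<zero>\<^bsub>P\<^esub> = \<zero>\<^bsub>Q\<^esub>"
    and "x \<in> carrier P \<Longrightarrow> y \<in> carrier P \<Longrightarrow> f (x \<ominus>\<^bsub>P\<^esub> y) = f x \<ominus>\<^bsub>Q\<^esub> f y"
proof -
  interpret P: abelian_group P by fact
  interpret Q: abelian_group Q by fact
  interpret f: group_hom "add_monoid P" "add_monoid Q" f
    using f add by unfold_locales (auto simp: hom_def)
  show "f \<zero>\<^bsub>P\<^esub> = \<zero>\<^bsub>Q\<^esub>"
    using f.hom_one by simp
  show "x \<in> carrier P \<Longrightarrow> y \<in> carrier P \<Longrightarrow> f (x \<ominus>\<^bsub>P\<^esub> y) = f x \<ominus>\<^bsub>Q\<^esub> f y"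
    using f.hom_inv[of y] add[of x "\<ominus>\<^bsub>P\<^esub> y"] by (simp add: P.minus_eq Q.minus_eq a_inv_def)
qed

lemma additive_frag_sum:
  assumes P: "abelian_group P" and Q: "abelian_group Q"
    and f: "f \<in> carrier P \<rightarrow> carrier Q"
    and add: "\<And>x y. x \<in> carrier P \<Longrightarrow> y \<in> carrier P \<Longrightarrow> f (x \<oplus>\<^bsub>P\<^esub> y) = f x \<oplus>\<^bsub>Q\<^esub> f y"
    and x: "Poly_Mapping.keys x \<subseteq> S" and \<beta>: "\<beta> \<in> S \<rightarrow> carrier P"
  shows "f (frag_sum P \<beta> x) = frag_sum Q (\<lambda>c. f (\<beta> c)) x"
proof -
  interpret P: abelian_group P by fact
  interpret Q: abelian_group Q by fact
  note f_minus = additive_minus[OF P Q f add]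
  have f\<beta>: "(\<lambda>c. f (\<beta> c)) \<in> S \<rightarrow> carrier Q"
    using f \<beta> by auto
  have "Poly_Mapping.keys x \<subseteq> S \<and> f (frag_sum P \<beta> x) = frag_sum Q (\<lambda>c. f (\<beta> c)) x"
    using x
  proof (induction x rule: frag_induction)
    case zero
    show ?case
      by (simp add: P.frag_sum_zero Q.frag_sum_zero f_minus(1))
  next
    case (one c)
    then have "\<beta> c \<in> carrier P" "f (\<beta> c) \<in> carrier Q"
      using \<beta> f by auto
    then show ?case
      using one by (simp add: P.frag_sum_of Q.frag_sum_of)
  next
    case (diff a b)
    then have "f (frag_sum P \<beta> (a - b)) = f (frag_sum P \<beta> a) \<ominus>\<^bsub>Q\<^esub> f (frag_sum P \<beta> b)"
      using P.frag_sum_closed[OF \<beta>] by (subst P.frag_sum_diff[OF \<beta>]) (auto simp: f_minus(2))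
    then show ?case
      using diff keys_diff[of a b] by (auto simp: Q.frag_sum_diff[OF f\<beta>])
  qed
  then show ?thesis ..
qed

context abelian_group
begin

text \<open>Interchange of two finite sums, by induction on \<open>x\<close>: for a generator both sides are the inner sum.\<close>

lemma frag_sum_swap:
  assumes x: "Poly_Mapping.keys x \<subseteq> S" and y: "Poly_Mapping.keys y \<subseteq> T"
    and \<gamma>: "\<And>c d. c \<in> S \<Longrightarrow> d \<in> T \<Longrightarrow> \<gamma> c d \<in> carrier G"
  shows "frag_sum G (\<lambda>c. frag_sum G (\<gamma> c) y) x = frag_sum G (\<lambda>d. frag_sum G (\<lambda>c. \<gamma> c d) x) y"
proof -
  have 1: "(\<lambda>c. frag_sum G (\<gamma> c) y) \<in> S \<rightarrow> carrier G"
    using frag_sum_closed[OF _ y] \<gamma> by auto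
  have 2: "(\<lambda>d. \<gamma> c d) \<in> T \<rightarrow> carrier G" if "c \<in> S" for c
    using \<gamma> that by auto
  have 3: "(\<lambda>c. \<gamma> c d) \<in> S \<rightarrow> carrier G" if "d \<in> T" for d
    using \<gamma> that by auto
  have "Poly_Mapping.keys x \<subseteq> S \<and>
    frag_sum G (\<lambda>c. frag_sum G (\<gamma> c) y) x = frag_sum G (\<lambda>d. frag_sum G (\<lambda>c. \<gamma> c d) x) y"
    using x
  proof (induction x rule: frag_induction)
    case zero
    show ?case
      by (simp add: frag_sum_zero) (simp add: frag_sum_def)
  next
    case (one c)
    have "frag_sum G (\<lambda>d. frag_sum G (\<lambda>c. \<gamma> c d) (frag_of c)) y = frag_sum G (\<gamma> c) y"
      using one \<gamma> 2[OF one] by (intro frag_sum_cong[OF y]) (simp_all add: frag_sum_of)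
    then show ?case
      using one 1 by (auto simp: frag_sum_of Pi_def)
  next
    case (diff a b)
    have a: "(\<lambda>d. frag_sum G (\<lambda>c. \<gamma> c d) a) \<in> T \<rightarrow> carrier G"
      and b: "(\<lambda>d. frag_sum G (\<lambda>c. \<gamma> c d) b) \<in> T \<rightarrow> carrier G"
      using diff frag_sum_closed[OF 3] by auto
    have b': "(\<lambda>d. \<ominus> frag_sum G (\<lambda>c. \<gamma> c d) b) \<in> T \<rightarrow> carrier G"
      using b by auto
    have "frag_sum G (\<lambda>d. frag_sum G (\<lambda>c. \<gamma> c d) (a - b)) y
      = frag_sum G (\<lambda>d. frag_sum G (\<lambda>c. \<gamma> c d) a \<oplus> \<ominus> frag_sum G (\<lambda>c. \<gamma> c d) b) y"
      using diff a b' frag_sum_diff[OF 3] by (intro frag_sum_cong[OF y]) (auto simp: minus_eq)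
    also have "\<dots> = frag_sum G (\<lambda>d. frag_sum G (\<lambda>c. \<gamma> c d) a) y
        \<oplus> frag_sum G (\<lambda>d. \<ominus> frag_sum G (\<lambda>c. \<gamma> c d) b) y"
      by (rule frag_sum_add[OF y a b'])
    also have "frag_sum G (\<lambda>d. \<ominus> frag_sum G (\<lambda>c. \<gamma> c d) b) y
      = \<ominus> frag_sum G (\<lambda>d. frag_sum G (\<lambda>c. \<gamma> c d) b) y"
      by (rule additive_frag_sum[OF abelian_group_axioms abelian_group_axioms _ _ y b, symmetric])
        (auto simp: minus_add)
    finally show ?case
      using diff keys_diff[of a b] by (auto simp: frag_sum_diff[OF 1] minus_eq)
  qed
  then show ?thesis ..
qed

lemma frag_sum_extend:
  assumes x: "Poly_Mapping.keys x \<subseteq> S" and f: "\<And>c. c \<in> S \<Longrightarrow> Poly_Mapping.keys (f c) \<subseteq> T"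
    and \<beta>: "\<beta> \<in> T \<rightarrow> carrier G"
  shows "frag_sum G \<beta> (frag_extend f x) = frag_sum G (\<lambda>c. frag_sum G \<beta> (f c)) x"
proof -
  have 1: "(\<lambda>c. frag_sum G \<beta> (f c)) \<in> S \<rightarrow> carrier G"
    using f frag_sum_closed[OF \<beta>] by auto
  have ext: "Poly_Mapping.keys (frag_extend f y) \<subseteq> T" if "Poly_Mapping.keys y \<subseteq> S" for y
    using keys_frag_extend[of f y] f that by blast
  have "Poly_Mapping.keys x \<subseteq> S \<and>
      frag_sum G \<beta> (frag_extend f x) = frag_sum G (\<lambda>c. frag_sum G \<beta> (f c)) x"
    using x
  proof (induction x rule: frag_induction)
    case (one c)
    then show ?case using 1 by (auto simp: frag_sum_of Pi_def)
  next
    case (diff a b)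
    then show ?case
      using keys_diff[of a b] ext by (auto simp: frag_extend_diff frag_sum_diff[OF \<beta>] frag_sum_diff[OF 1])
  qed (simp add: frag_sum_zero)
  then show ?thesis ..
qed

end

section \<open>Induced maps on tensor products\<close>

lemma tensor_lift_frag_sum:
  "tensor_lift P \<beta> X = frag_sum P (\<lambda>c. \<beta> (fst c) (snd c)) (representative X)"
  by (simp add: tensor_lift_def frag_sum_def Let_def)

text \<open>Two kinds of rules for induced maps follow. Closure, congruence, additivity in \<open>\<beta>\<close>, composition with
  an additive map and interchange concern the sum over one fixed representative. Sums, multiples and
  products of tensors change the representative; there the value is recomputed from the definition
  of the operation, which is legitimate because \<open>\<beta>\<close> is balanced.\<close>

locale tensor_factors = M?: module k M + N?: module k N
  for k :: "('k, 'r) ring_scheme" (structure)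
    and M :: "('k, 'b, 'm) module_scheme" (structure)
    and N :: "('k, 'e, 'n) module_scheme" (structure)
begin

abbreviation "T \<equiv> tensor_product k M N"

lemma T_abelian: "abelian_group T"
  by (rule abelian_group_tensor_product[OF M.module_axioms N.module_axioms])

sublocale T: abelian_group T
  by (rule T_abelian)

lemma carrier_T: "carrier T = tensor_class k M N ` {x. Poly_Mapping.keys x \<subseteq> carrier M \<times> carrier N}"
  by (auto simp: tensor_product_def carrier_FactGroup tensor_class_def carrier_tensor_free)

lemma representative_class:
  assumes "X \<in> carrier T"
  shows "Poly_Mapping.keys (representative X) \<subseteq> carrier M \<times> carrier N"
    and "tensor_class k M N (representative X) = X"
proof -
  interpret F: comm_group "tensor_free M N" by (rule comm_group_tensor_free)
  note sub = subgroup_tensor_null[OF M.module_axioms N.module_axioms]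
  obtain x where x: "x \<in> carrier (tensor_free M N)" "X = tensor_class k M N x"
    using assms unfolding carrier_T by (auto simp: carrier_tensor_free)
  have "x \<in> X"
    unfolding x tensor_class_def by (rule F.rcos_self[OF x(1) sub])
  then have rep: "representative X \<in> X"
    unfolding representative_def by (rule someI)
  have "X \<subseteq> carrier (tensor_free M N)"
    unfolding x tensor_class_def by (rule F.r_coset_subset_G[OF subgroup.subset[OF sub] x(1)])
  then show "Poly_Mapping.keys (representative X) \<subseteq> carrier M \<times> carrier N"
    using rep carrier_tensor_free by blast
  show "tensor_class k M N (representative X) = X"
    using F.repr_independence[OF _ x(1) sub] rep by (simp add: x tensor_class_def)
qed

lemma pure_closed:
  assumes "a \<in> carrier M" "b \<in> carrier N"
  shows "pure_tensor k M N a b \<in> carrier T"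
  using assms unfolding pure_tensor_def carrier_T by (intro imageI) auto

lemma class_add:
  assumes x: "Poly_Mapping.keys x \<subseteq> carrier M \<times> carrier N" and y: "Poly_Mapping.keys y \<subseteq> carrier M \<times> carrier N"
  shows "tensor_class k M N (x + y) = tensor_class k M N x \<oplus>\<^bsub>T\<^esub> tensor_class k M N y"
proof -
  interpret F: comm_group "tensor_free M N" by (rule comm_group_tensor_free)
  have nrm: "tensor_null k M N \<lhd> tensor_free M N"
    by (rule F.subgroup_imp_normal[OF subgroup_tensor_null[OF M.module_axioms N.module_axioms]])
  show ?thesis
    using normal.rcos_sum[OF nrm, of x y] x y
    by (simp add: tensor_product_def tensor_class_def carrier_tensor_free)
qed

lemma class_diff:
  assumes "Poly_Mapping.keys x \<subseteq> carrier M \<times> carrier N" "Poly_Mapping.keys y \<subseteq> carrier M \<times> carrier N"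
  shows "tensor_class k M N (x - y) = tensor_class k M N x \<ominus>\<^bsub>T\<^esub> tensor_class k M N y"
proof -
  have cl: "tensor_class k M N z \<in> carrier T" if "Poly_Mapping.keys z \<subseteq> carrier M \<times> carrier N" for z
    using that unfolding carrier_T by blast
  have xy: "Poly_Mapping.keys (x - y) \<subseteq> carrier M \<times> carrier N"
    using assms keys_diff[of x y] by blast
  have "tensor_class k M N (x - y) \<oplus>\<^bsub>T\<^esub> tensor_class k M N y = tensor_class k M N x"
    using class_add[OF xy assms(2)] by simp
  then show ?thesis
    using cl[OF xy] cl[OF assms(1)] cl[OF assms(2)]
    by (metis T.add.inv_solve_right' T.minus_eq)
qed

lemma class_zero: "tensor_class k M N 0 = \<zero>\<^bsub>T\<^esub>"
proof -
  have "tensor_class k M N 0 \<in> carrier T"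
    unfolding carrier_T by simp
  then show ?thesis
    using class_diff[of 0 0] by (simp add: T.minus_eq T.r_neg)
qed

lemma class_eq_frag_sum:
  assumes "Poly_Mapping.keys x \<subseteq> carrier M \<times> carrier N"
  shows "tensor_class k M N x = frag_sum T (\<lambda>c. pure_tensor k M N (fst c) (snd c)) x"
proof -
  have \<beta>: "(\<lambda>c. pure_tensor k M N (fst c) (snd c)) \<in> carrier M \<times> carrier N \<rightarrow> carrier T"
    using pure_closed by auto
  have "Poly_Mapping.keys x \<subseteq> carrier M \<times> carrier N \<and>
     tensor_class k M N x = frag_sum T (\<lambda>c. pure_tensor k M N (fst c) (snd c)) x"
    using assms
  proof (induction x rule: frag_induction)
    case zero
    show ?case by (simp add: T.frag_sum_zero class_zero)
  next
    case (one c)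
    then show ?case
      using pure_closed by (subst T.frag_sum_of) (auto simp: pure_tensor_def)
  next
    case (diff a b)
    then show ?case
      using keys_diff[of a b] by (auto simp: class_diff T.frag_sum_diff[OF \<beta>])
  qed
  then show ?thesis ..
qed

lemma tensor_lift_closed:
  assumes "abelian_group P" "X \<in> carrier T"
    and "\<And>a b. a \<in> carrier M \<Longrightarrow> b \<in> carrier N \<Longrightarrow> \<beta> a b \<in> carrier P"
  shows "tensor_lift P \<beta> X \<in> carrier P"
  unfolding tensor_lift_frag_sum
  by (rule abelian_group.frag_sum_closed[where S = "carrier M \<times> carrier N"])
    (use representative_class(1)[OF assms(2)] assms in auto)

lemma tensor_lift_cong:
  assumes "abelian_group P" "X \<in> carrier T"
    and "\<And>a b. a \<in> carrier M \<Longrightarrow> b \<in> carrier N \<Longrightarrow> \<beta> a b = \<gamma> a b"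
    and "\<And>a b. a \<in> carrier M \<Longrightarrow> b \<in> carrier N \<Longrightarrow> \<gamma> a b \<in> carrier P"
  shows "tensor_lift P \<beta> X = tensor_lift P \<gamma> X"
  unfolding tensor_lift_frag_sum
  by (rule abelian_group.frag_sum_cong[where S = "carrier M \<times> carrier N"])
    (use representative_class(1)[OF assms(2)] assms in auto)

lemma additive_tensor_lift:
  assumes "abelian_group P" "abelian_group Q" "X \<in> carrier T"
    and "f \<in> carrier P \<rightarrow> carrier Q"
    and "\<And>x y. x \<in> carrier P \<Longrightarrow> y \<in> carrier P \<Longrightarrow> f (x \<oplus>\<^bsub>P\<^esub> y) = f x \<oplus>\<^bsub>Q\<^esub> f y"
    and "\<And>a b. a \<in> carrier M \<Longrightarrow> b \<in> carrier N \<Longrightarrow> \<beta> a b \<in> carrier P"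
  shows "f (tensor_lift P \<beta> X) = tensor_lift Q (\<lambda>a b. f (\<beta> a b)) X"
  unfolding tensor_lift_frag_sum
  by (rule additive_frag_sum[where S = "carrier M \<times> carrier N"])
    (use representative_class(1)[OF assms(3)] assms in auto)

lemma tensor_lift_plus:
  assumes "abelian_group P" "X \<in> carrier T"
    and "\<And>a b. a \<in> carrier M \<Longrightarrow> b \<in> carrier N \<Longrightarrow> \<beta> a b \<in> carrier P"
    and "\<And>a b. a \<in> carrier M \<Longrightarrow> b \<in> carrier N \<Longrightarrow> \<gamma> a b \<in> carrier P"
  shows "tensor_lift P (\<lambda>a b. \<beta> a b \<oplus>\<^bsub>P\<^esub> \<gamma> a b) X = tensor_lift P \<beta> X \<oplus>\<^bsub>P\<^esub> tensor_lift P \<gamma> X"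
  unfolding tensor_lift_frag_sum
  by (rule abelian_group.frag_sum_add[where S = "carrier M \<times> carrier N"])
    (use representative_class(1)[OF assms(2)] assms in auto)

lemma tensor_lift_pure_self:
  assumes "X \<in> carrier T"
  shows "tensor_lift T (pure_tensor k M N) X = X"
  using class_eq_frag_sum[OF representative_class(1)[OF assms]] representative_class(2)[OF assms]
  by (simp add: tensor_lift_frag_sum)

lemma tensor_lift_class_sum:
  assumes "abelian_group P" "balanced k M N P \<beta>" "Poly_Mapping.keys x \<subseteq> carrier M \<times> carrier N"
  shows "tensor_lift P \<beta> (tensor_class k M N x) = frag_sum P (\<lambda>c. \<beta> (fst c) (snd c)) x"
  unfolding frag_sum_def using assms by (intro tensor_lift_class M.module_axioms N.module_axioms)

lemma tensor_lift_smult: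
  assumes P: "abelian_group P" and bal: "balanced k M N P \<beta>" and X: "X \<in> carrier T" and r: "r \<in> carrier k"
  shows "tensor_lift P \<beta> (r \<odot>\<^bsub>T\<^esub> X) = tensor_lift P (\<lambda>a b. \<beta> (r \<odot>\<^bsub>M\<^esub> a) b) X"
proof -
  interpret P: abelian_group P by fact
  let ?f = "\<lambda>(a, b). frag_of (r \<odot>\<^bsub>M\<^esub> a, b)" and ?x = "representative X" and ?S = "carrier M \<times> carrier N"
  note x = representative_class(1)[OF X]
  have \<beta>: "(\<lambda>c. \<beta> (fst c) (snd c)) \<in> ?S \<rightarrow> carrier P"
    using bal by (auto simp: balanced_def)
  have f: "Poly_Mapping.keys (?f c) \<subseteq> ?S" if "c \<in> ?S" for c
    using that r by auto
  have "tensor_lift P \<beta> (r \<odot>\<^bsub>T\<^esub> X) = tensor_lift P \<beta> (tensor_class k M N (frag_extend ?f ?x))"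
    by (simp add: tensor_product_def)
  also have "\<dots> = frag_sum P (\<lambda>c. \<beta> (fst c) (snd c)) (frag_extend ?f ?x)"
    using keys_frag_extend[of ?f ?x] f x by (intro tensor_lift_class_sum[OF P bal]) blast
  also have "\<dots> = frag_sum P (\<lambda>c. frag_sum P (\<lambda>c. \<beta> (fst c) (snd c)) (?f c)) ?x"
    by (rule P.frag_sum_extend[OF x f \<beta>])
  also have "\<dots> = frag_sum P (\<lambda>c. \<beta> (r \<odot>\<^bsub>M\<^esub> fst c) (snd c)) ?x"
    using bal r by (intro P.frag_sum_cong[OF x]) (auto simp: balanced_def P.frag_sum_of)
  finally show ?thesis
    by (simp add: tensor_lift_frag_sum)
qed

lemma smult_closed_T:
  assumes X: "X \<in> carrier T" and r: "r \<in> carrier k"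
  shows "r \<odot>\<^bsub>T\<^esub> X \<in> carrier T"
proof -
  let ?f = "\<lambda>(a, b). frag_of (r \<odot>\<^bsub>M\<^esub> a, b)" and ?x = "representative X"
  have "Poly_Mapping.keys (?f c) \<subseteq> carrier M \<times> carrier N" if "c \<in> carrier M \<times> carrier N" for c
    using that r by auto
  then have "Poly_Mapping.keys (frag_extend ?f ?x) \<subseteq> carrier M \<times> carrier N"
    using keys_frag_extend[of ?f ?x] representative_class(1)[OF X] by blast
  then show ?thesis
    unfolding carrier_T by (simp add: tensor_product_def)
qed

lemma class_eqI:
  assumes "x - y \<in> tensor_relations k M N"
    and x: "Poly_Mapping.keys x \<subseteq> carrier M \<times> carrier N" and y: "Poly_Mapping.keys y \<subseteq> carrier M \<times> carrier N"
  shows "tensor_class k M N x = tensor_class k M N y"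
proof -
  interpret F: comm_group "tensor_free M N" by (rule comm_group_tensor_free)
  have "x - y \<in> tensor_null k M N"
    unfolding tensor_null_def using assms(1) by (rule generate.incl)
  then have "x \<in> tensor_null k M N #>\<^bsub>tensor_free M N\<^esub> y"
    by (auto simp: r_coset_def intro!: bexI[of _ "x - y"])
  then show ?thesis
    unfolding tensor_class_def
    using F.repr_independence[OF _ _ subgroup_tensor_null[OF M.module_axioms N.module_axioms]] y
    by (simp add: carrier_tensor_free)
qed

lemma balanced_pure: "balanced k M N T (pure_tensor k M N)"
  unfolding balanced_def
proof (intro conjI ballI)
  fix a a' b assume *: "a \<in> carrier M" "a' \<in> carrier M" "b \<in> carrier N"
  have "tensor_class k M N (frag_of (a \<oplus>\<^bsub>M\<^esub> a', b)) = tensor_class k M N (frag_of (a, b) + frag_of (a', b))"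
  proof (rule class_eqI)
    show "frag_of (a \<oplus>\<^bsub>M\<^esub> a', b) - (frag_of (a, b) + frag_of (a', b)) \<in> tensor_relations k M N"
      unfolding tensor_relations_def using * by blast
  qed (use * Poly_Mapping.keys_add[of "frag_of (a, b)" "frag_of (a', b)"] in auto)
  then show "pure_tensor k M N (a \<oplus>\<^bsub>M\<^esub> a') b = pure_tensor k M N a b \<oplus>\<^bsub>T\<^esub> pure_tensor k M N a' b"
    using * by (simp add: pure_tensor_def class_add)
next
  fix a b b' assume *: "a \<in> carrier M" "b \<in> carrier N" "b' \<in> carrier N"
  have "tensor_class k M N (frag_of (a, b \<oplus>\<^bsub>N\<^esub> b')) = tensor_class k M N (frag_of (a, b) + frag_of (a, b'))"
  proof (rule class_eqI)
    show "frag_of (a, b \<oplus>\<^bsub>N\<^esub> b') - (frag_of (a, b) + frag_of (a, b')) \<in> tensor_relations k M N"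
      unfolding tensor_relations_def using * by blast
  qed (use * Poly_Mapping.keys_add[of "frag_of (a, b)" "frag_of (a, b')"] in auto)
  then show "pure_tensor k M N a (b \<oplus>\<^bsub>N\<^esub> b') = pure_tensor k M N a b \<oplus>\<^bsub>T\<^esub> pure_tensor k M N a b'"
    using * by (simp add: pure_tensor_def class_add)
next
  fix r a b assume *: "r \<in> carrier k" "a \<in> carrier M" "b \<in> carrier N"
  show "pure_tensor k M N (r \<odot>\<^bsub>M\<^esub> a) b = pure_tensor k M N a (r \<odot>\<^bsub>N\<^esub> b)"
    unfolding pure_tensor_def
  proof (rule class_eqI)
    show "frag_of (r \<odot>\<^bsub>M\<^esub> a, b) - frag_of (a, r \<odot>\<^bsub>N\<^esub> b) \<in> tensor_relations k M N"
      unfolding tensor_relations_def using * by blast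
  qed (use * in auto)
next
  fix a b assume "a \<in> carrier M" "b \<in> carrier N"
  then show "pure_tensor k M N a b \<in> carrier T"
    by (rule pure_closed)
qed

text \<open>Scalar multiplication is the endomorphism induced by the balanced map \<open>(a, b) \<mapsto> r a \<otimes> b\<close>. All module
  axioms for the tensor product are read off from this description.\<close>

lemma smult_T:
  assumes X: "X \<in> carrier T" and r: "r \<in> carrier k"
  shows "r \<odot>\<^bsub>T\<^esub> X = tensor_lift T (\<lambda>a b. pure_tensor k M N (r \<odot>\<^bsub>M\<^esub> a) b) X"
  by (rule trans[OF tensor_lift_pure_self[OF smult_closed_T[OF X r], symmetric]
        tensor_lift_smult[OF T_abelian balanced_pure X r]])

lemma module_tensor_product: "module k T"
proof -
  note [simp] = pure_closed
  have pure: "pure_tensor k M N (a \<oplus>\<^bsub>M\<^esub> a') b = pure_tensor k M N a b \<oplus>\<^bsub>T\<^esub> pure_tensor k M N a' b"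
    "pure_tensor k M N a (b \<oplus>\<^bsub>N\<^esub> b') = pure_tensor k M N a b \<oplus>\<^bsub>T\<^esub> pure_tensor k M N a b'"
    "r \<in> carrier k \<Longrightarrow> pure_tensor k M N (r \<odot>\<^bsub>M\<^esub> a) b = pure_tensor k M N a (r \<odot>\<^bsub>N\<^esub> b)"
    if "a \<in> carrier M" "a' \<in> carrier M" "b \<in> carrier N" "b' \<in> carrier N" for a a' b b' r
    using balanced_pure that unfolding balanced_def by blast+
  have bal: "balanced k M N T (\<lambda>a b. pure_tensor k M N (r \<odot>\<^bsub>M\<^esub> a) b)" if "r \<in> carrier k" for r
    unfolding balanced_def
  proof (intro conjI ballI)
    fix s a b assume *: "s \<in> carrier k" "a \<in> carrier M" "b \<in> carrier N"
    have "r \<odot>\<^bsub>M\<^esub> (s \<odot>\<^bsub>M\<^esub> a) = s \<odot>\<^bsub>M\<^esub> (r \<odot>\<^bsub>M\<^esub> a)"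
      using * that M.smult_assoc1[of r s a] M.smult_assoc1[of s r a] M.R.m_comm[of r s] by simp
    then show "pure_tensor k M N (r \<odot>\<^bsub>M\<^esub> (s \<odot>\<^bsub>M\<^esub> a)) b = pure_tensor k M N (r \<odot>\<^bsub>M\<^esub> a) (s \<odot>\<^bsub>N\<^esub> b)"
      using pure(3)[of "r \<odot>\<^bsub>M\<^esub> a" "r \<odot>\<^bsub>M\<^esub> a" b b s] * that by simp
  qed (use that in \<open>simp_all add: pure(1,2) M.smult_r_distr\<close>)
  have add: "r \<odot>\<^bsub>T\<^esub> (X \<oplus>\<^bsub>T\<^esub> Y) = r \<odot>\<^bsub>T\<^esub> X \<oplus>\<^bsub>T\<^esub> r \<odot>\<^bsub>T\<^esub> Y"
    if "r \<in> carrier k" "X \<in> carrier T" "Y \<in> carrier T" for r X Y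
    using that tensor_lift_add[OF M.module_axioms N.module_axioms T_abelian bal[OF that(1)] that(2,3)]
    by (simp add: smult_T)
  show ?thesis
  proof (rule moduleI)
    fix r s X assume *: "r \<in> carrier k" "s \<in> carrier k" "X \<in> carrier T"
    show "(r \<oplus> s) \<odot>\<^bsub>T\<^esub> X = r \<odot>\<^bsub>T\<^esub> X \<oplus>\<^bsub>T\<^esub> s \<odot>\<^bsub>T\<^esub> X"
    proof -
      have "(r \<oplus> s) \<odot>\<^bsub>T\<^esub> X = tensor_lift T (\<lambda>a b. pure_tensor k M N (r \<odot>\<^bsub>M\<^esub> a) b
          \<oplus>\<^bsub>T\<^esub> pure_tensor k M N (s \<odot>\<^bsub>M\<^esub> a) b) X"
        unfolding smult_T[OF *(3) M.R.a_closed[OF *(1,2)]] using *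
        by (intro tensor_lift_cong T_abelian) (auto simp: M.smult_l_distr pure(1))
      also have "\<dots> = r \<odot>\<^bsub>T\<^esub> X \<oplus>\<^bsub>T\<^esub> s \<odot>\<^bsub>T\<^esub> X"
        using * by (simp add: smult_T tensor_lift_plus[OF T_abelian])
      finally show ?thesis .
    qed
    show "(r \<otimes> s) \<odot>\<^bsub>T\<^esub> X = r \<odot>\<^bsub>T\<^esub> (s \<odot>\<^bsub>T\<^esub> X)"
    proof -
      have pr: "r \<odot>\<^bsub>T\<^esub> pure_tensor k M N a b = pure_tensor k M N (r \<odot>\<^bsub>M\<^esub> a) b"
        if "a \<in> carrier M" "b \<in> carrier N" for a b
        using that * by (simp add: smult_T
            tensor_lift_pure[OF M.module_axioms N.module_axioms T_abelian bal])
      have "r \<odot>\<^bsub>T\<^esub> (s \<odot>\<^bsub>T\<^esub> X) = tensor_lift T (\<lambda>a b. r \<odot>\<^bsub>T\<^esub> pure_tensor k M N (s \<odot>\<^bsub>M\<^esub> a) b) X"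
        unfolding smult_T[OF *(3,2)] using * add
        by (intro additive_tensor_lift T_abelian) (auto simp: smult_closed_T)
      also have "\<dots> = tensor_lift T (\<lambda>a b. pure_tensor k M N ((r \<otimes> s) \<odot>\<^bsub>M\<^esub> a) b) X"
        using * by (intro tensor_lift_cong T_abelian) (auto simp: M.smult_assoc1 pr)
      finally show ?thesis
        using * by (simp add: smult_T)
    qed
  next
    fix X assume *: "X \<in> carrier T"
    have "\<one> \<odot>\<^bsub>T\<^esub> X = tensor_lift T (pure_tensor k M N) X"
      unfolding smult_T[OF * M.R.one_closed] using *
      by (intro tensor_lift_cong T_abelian) auto
    then show "\<one> \<odot>\<^bsub>T\<^esub> X = X"
      using * by (simp add: tensor_lift_pure_self)
  qed (auto simp: M.R.is_cring T_abelian smult_closed_T add)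
qed

end

lemma tensor_lift_swap:
  assumes 1: "tensor_factors k M N" and 2: "tensor_factors k' M' N'" and P: "abelian_group P"
    and X: "X \<in> carrier (tensor_product k M N)" and Y: "Y \<in> carrier (tensor_product k' M' N')"
    and \<gamma>: "\<And>a b c d. a \<in> carrier M \<Longrightarrow> b \<in> carrier N \<Longrightarrow> c \<in> carrier M' \<Longrightarrow> d \<in> carrier N'
      \<Longrightarrow> \<gamma> a b c d \<in> carrier P"
  shows "tensor_lift P (\<lambda>a b. tensor_lift P (\<lambda>c d. \<gamma> a b c d) Y) X
    = tensor_lift P (\<lambda>c d. tensor_lift P (\<lambda>a b. \<gamma> a b c d) X) Y"
  unfolding tensor_lift_frag_sum
  by (rule abelian_group.frag_sum_swap[OF P tensor_factors.representative_class(1)[OF 1 X]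
        tensor_factors.representative_class(1)[OF 2 Y]])
    (use \<gamma> in auto)

context tensor_factors
begin

text \<open>The product of two tensors is defined on representatives as a double sum of \<open>a c \<otimes> b d\<close>; extending
  linearly in both places turns it into a double sum of values of \<open>\<beta>\<close>.\<close>

lemma tensor_lift_mult:
  assumes P: "abelian_group P" and bal: "balanced k M N P \<beta>" and X: "X \<in> carrier T" and Y: "Y \<in> carrier T"
    and M_closed: "\<And>a c. a \<in> carrier M \<Longrightarrow> c \<in> carrier M \<Longrightarrow> a \<otimes>\<^bsub>M\<^esub> c \<in> carrier M"
    and N_closed: "\<And>b d. b \<in> carrier N \<Longrightarrow> d \<in> carrier N \<Longrightarrow> b \<otimes>\<^bsub>N\<^esub> d \<in> carrier N"
  shows "tensor_lift P \<beta> (X \<otimes>\<^bsub>T\<^esub> Y)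
    = tensor_lift P (\<lambda>a b. tensor_lift P (\<lambda>c d. \<beta> (a \<otimes>\<^bsub>M\<^esub> c) (b \<otimes>\<^bsub>N\<^esub> d)) Y) X"
proof -
  interpret P: abelian_group P by fact
  let ?S = "carrier M \<times> carrier N"
  let ?x = "representative X" and ?y = "representative Y"
  let ?g = "\<lambda>c d. frag_of (fst c \<otimes>\<^bsub>M\<^esub> fst d, snd c \<otimes>\<^bsub>N\<^esub> snd d)"
  let ?f = "\<lambda>c. frag_extend (?g c) ?y"
  note x = representative_class(1)[OF X] and y = representative_class(1)[OF Y]
  have \<beta>: "(\<lambda>c. \<beta> (fst c) (snd c)) \<in> ?S \<rightarrow> carrier P"
    using bal by (auto simp: balanced_def)
  have g: "Poly_Mapping.keys (?g c d) \<subseteq> ?S" if "c \<in> ?S" "d \<in> ?S" for c d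
    using that M_closed N_closed by auto
  have f: "Poly_Mapping.keys (?f c) \<subseteq> ?S" if "c \<in> ?S" for c
    using keys_frag_extend[of "?g c" ?y] g[OF that] y by blast
  have gP: "\<beta> (fst c \<otimes>\<^bsub>M\<^esub> fst d) (snd c \<otimes>\<^bsub>N\<^esub> snd d) \<in> carrier P" if "c \<in> ?S" "d \<in> ?S" for c d
    using that M_closed N_closed bal by (auto simp: balanced_def)
  have inner: "frag_sum P (\<lambda>c. \<beta> (fst c) (snd c)) (?f c)
      = frag_sum P (\<lambda>d. \<beta> (fst c \<otimes>\<^bsub>M\<^esub> fst d) (snd c \<otimes>\<^bsub>N\<^esub> snd d)) ?y" if c: "c \<in> ?S" for c
  proof -
    have "frag_sum P (\<lambda>c. \<beta> (fst c) (snd c)) (?f c)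
      = frag_sum P (\<lambda>d. frag_sum P (\<lambda>c. \<beta> (fst c) (snd c)) (?g c d)) ?y"
      by (rule P.frag_sum_extend[OF y g[OF c] \<beta>])
    also have "\<dots> = frag_sum P (\<lambda>d. \<beta> (fst c \<otimes>\<^bsub>M\<^esub> fst d) (snd c \<otimes>\<^bsub>N\<^esub> snd d)) ?y"
      using gP[OF c] by (intro P.frag_sum_cong[OF y]) (simp_all add: P.frag_sum_of)
    finally show ?thesis .
  qed
  have "X \<otimes>\<^bsub>T\<^esub> Y = tensor_class k M N (frag_extend ?f ?x)"
    by (simp add: tensor_product_def case_prod_unfold)
  also have "tensor_lift P \<beta> \<dots> = frag_sum P (\<lambda>c. \<beta> (fst c) (snd c)) (frag_extend ?f ?x)"
    using keys_frag_extend[of ?f ?x] f x by (intro tensor_lift_class_sum[OF P bal]) blast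
  also have "\<dots> = frag_sum P (\<lambda>c. frag_sum P (\<lambda>c. \<beta> (fst c) (snd c)) (?f c)) ?x"
    by (rule P.frag_sum_extend[OF x f \<beta>])
  also have "\<dots> = frag_sum P (\<lambda>c. frag_sum P (\<lambda>d. \<beta> (fst c \<otimes>\<^bsub>M\<^esub> fst d) (snd c \<otimes>\<^bsub>N\<^esub> snd d)) ?y) ?x"
    using gP by (intro P.frag_sum_cong[OF x] inner) (auto intro!: P.frag_sum_closed[OF _ y])
  finally show ?thesis
    by (simp add: tensor_lift_frag_sum)
qed

end

section \<open>Sums over the comultiplication\<close>

context hopf_algebra
begin

sublocale HH: tensor_factors k H H
  by (intro tensor_factors.intro module_axioms)

sublocale HHH: tensor_factors k H "tensor_product k H H"
  by (intro tensor_factors.intro module_axioms HH.module_tensor_product)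

text \<open>Sigma notation: this is \<open>\<Sum> \<beta> h\<^sub>1 h\<^sub>2\<close>.\<close>

abbreviation sweedler :: "('p, 'q) ring_scheme \<Rightarrow> ('b \<Rightarrow> 'b \<Rightarrow> 'p) \<Rightarrow> 'b \<Rightarrow> 'p" where
  "sweedler P \<beta> h \<equiv> tensor_lift P \<beta> (\<Delta> h)"

lemma H_abelian: "abelian_group H"
  by (rule M.abelian_group_axioms)

lemma \<Delta>_closed [simp]: "h \<in> carrier H \<Longrightarrow> \<Delta> h \<in> carrier HH.T"
  by (rule ring_hom_closed[OF \<Delta>_hom])

lemma \<epsilon>_closed [simp]: "h \<in> carrier H \<Longrightarrow> \<epsilon> h \<in> carrier k"
  by (rule ring_hom_closed[OF \<epsilon>_hom])

declare S_closed [simp]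

lemma sweedler_additive:
  assumes "abelian_group P" and "abelian_group Q" and "h \<in> carrier H"
    and "\<And>x. x \<in> carrier P \<Longrightarrow> f x \<in> carrier Q"
    and "\<And>x y. x \<in> carrier P \<Longrightarrow> y \<in> carrier P \<Longrightarrow> f (x \<oplus>\<^bsub>P\<^esub> y) = f x \<oplus>\<^bsub>Q\<^esub> f y"
    and "\<And>a b. a \<in> carrier H \<Longrightarrow> b \<in> carrier H \<Longrightarrow> \<beta> a b \<in> carrier P"
  shows "f (sweedler P \<beta> h) = sweedler Q (\<lambda>a b. f (\<beta> a b)) h"
  by (rule HH.additive_tensor_lift[OF assms(1,2) \<Delta>_closed[OF assms(3)] funcsetI assms(5,6)])
    (rule assms(4))

lemma sweedler_closed:
  assumes "abelian_group P" "h \<in> carrier H"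
    and "\<And>a b. a \<in> carrier H \<Longrightarrow> b \<in> carrier H \<Longrightarrow> \<beta> a b \<in> carrier P"
  shows "sweedler P \<beta> h \<in> carrier P"
  by (rule HH.tensor_lift_closed[OF assms(1) \<Delta>_closed[OF assms(2)] assms(3)])

lemma sweedler_cong:
  assumes "abelian_group P" "h \<in> carrier H"
    and "\<And>a b. a \<in> carrier H \<Longrightarrow> b \<in> carrier H \<Longrightarrow> \<beta> a b = \<gamma> a b"
    and "\<And>a b. a \<in> carrier H \<Longrightarrow> b \<in> carrier H \<Longrightarrow> \<gamma> a b \<in> carrier P"
  shows "sweedler P \<beta> h = sweedler P \<gamma> h"
  by (rule HH.tensor_lift_cong[OF assms(1) \<Delta>_closed[OF assms(2)] assms(3,4)])

lemma sweedler_plus: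
  assumes "abelian_group P" "h \<in> carrier H"
    and "\<And>a b. a \<in> carrier H \<Longrightarrow> b \<in> carrier H \<Longrightarrow> \<beta> a b \<in> carrier P"
    and "\<And>a b. a \<in> carrier H \<Longrightarrow> b \<in> carrier H \<Longrightarrow> \<gamma> a b \<in> carrier P"
  shows "sweedler P (\<lambda>a b. \<beta> a b \<oplus>\<^bsub>P\<^esub> \<gamma> a b) h = sweedler P \<beta> h \<oplus>\<^bsub>P\<^esub> sweedler P \<gamma> h"
  by (rule HH.tensor_lift_plus[OF assms(1) \<Delta>_closed[OF assms(2)] assms(3,4)])

lemma sweedler_swap:
  assumes "abelian_group P" "g \<in> carrier H" "h \<in> carrier H"
    and "\<And>a b c d. a \<in> carrier H \<Longrightarrow> b \<in> carrier H \<Longrightarrow> c \<in> carrier H \<Longrightarrow> d \<in> carrier H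
      \<Longrightarrow> \<gamma> a b c d \<in> carrier P"
  shows "sweedler P (\<lambda>a b. sweedler P (\<lambda>c d. \<gamma> a b c d) h) g
    = sweedler P (\<lambda>c d. sweedler P (\<lambda>a b. \<gamma> a b c d) g) h"
  by (rule tensor_lift_swap[OF HH.tensor_factors_axioms HH.tensor_factors_axioms assms(1)
        \<Delta>_closed[OF assms(2)] \<Delta>_closed[OF assms(3)] assms(4)])

lemma sweedler_smult:
  assumes "abelian_group P" "balanced k H H P \<beta>" "r \<in> carrier k" "h \<in> carrier H"
  shows "sweedler P \<beta> (r \<odot>\<^bsub>H\<^esub> h) = sweedler P (\<lambda>a b. \<beta> (r \<odot>\<^bsub>H\<^esub> a) b) h"
  unfolding \<Delta>_smult[OF assms(3,4)]
  by (rule HH.tensor_lift_smult[OF assms(1,2) \<Delta>_closed[OF assms(4)] assms(3)])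

lemma sweedler_mult:
  assumes "abelian_group P" "balanced k H H P \<beta>" "g \<in> carrier H" "h \<in> carrier H"
  shows "sweedler P \<beta> (g \<otimes>\<^bsub>H\<^esub> h)
    = sweedler P (\<lambda>a b. sweedler P (\<lambda>c d. \<beta> (a \<otimes>\<^bsub>H\<^esub> c) (b \<otimes>\<^bsub>H\<^esub> d)) h) g"
  unfolding ring_hom_mult[OF \<Delta>_hom assms(3,4)]
  by (rule HH.tensor_lift_mult[OF assms(1,2) \<Delta>_closed[OF assms(3)] \<Delta>_closed[OF assms(4)]]) simp_all

lemma sweedler_counit_left:
  assumes "abelian_group P" "h \<in> carrier H"
    and "\<And>x. x \<in> carrier H \<Longrightarrow> f x \<in> carrier P"
    and "\<And>x y. x \<in> carrier H \<Longrightarrow> y \<in> carrier H \<Longrightarrow> f (x \<oplus>\<^bsub>H\<^esub> y) = f x \<oplus>\<^bsub>P\<^esub> f y"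
  shows "sweedler P (\<lambda>a b. f (\<epsilon> a \<odot>\<^bsub>H\<^esub> b)) h = f h"
  using sweedler_additive[OF H_abelian assms(1,2), of f "\<lambda>a b. \<epsilon> a \<odot>\<^bsub>H\<^esub> b"] assms(3,4)
  by (simp add: counit_left[OF assms(2)])

lemma sweedler_counit_right:
  assumes "abelian_group P" "h \<in> carrier H"
    and "\<And>x. x \<in> carrier H \<Longrightarrow> f x \<in> carrier P"
    and "\<And>x y. x \<in> carrier H \<Longrightarrow> y \<in> carrier H \<Longrightarrow> f (x \<oplus>\<^bsub>H\<^esub> y) = f x \<oplus>\<^bsub>P\<^esub> f y"
  shows "sweedler P (\<lambda>a b. f (\<epsilon> b \<odot>\<^bsub>H\<^esub> a)) h = f h"
  using sweedler_additive[OF H_abelian assms(1,2), of f "\<lambda>a b. \<epsilon> b \<odot>\<^bsub>H\<^esub> a"] assms(3,4)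
  by (simp add: counit_right[OF assms(2)])

text \<open>A trilinear \<open>\<gamma>\<close> induces a balanced map \<open>\<Gamma>\<close> on \<open>H \<times> (H \<otimes> H)\<close> and hence a map \<open>f\<close> on
  \<open>H \<otimes> (H \<otimes> H)\<close>. Applying \<open>f\<close> to both sides of the coassociativity axiom gives the identity between
  iterated sums that justifies writing \<open>\<Sum> \<gamma> h\<^sub>1 h\<^sub>2 h\<^sub>3\<close>.\<close>

lemma sweedler_coassoc:
  assumes P: "abelian_group P" and h: "h \<in> carrier H"
    and cl: "\<And>a b c. a \<in> carrier H \<Longrightarrow> b \<in> carrier H \<Longrightarrow> c \<in> carrier H \<Longrightarrow> \<gamma> a b c \<in> carrier P"
    and add1: "\<And>a a' b c. a \<in> carrier H \<Longrightarrow> a' \<in> carrier H \<Longrightarrow> b \<in> carrier H \<Longrightarrow> c \<in> carrier H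
      \<Longrightarrow> \<gamma> (a \<oplus>\<^bsub>H\<^esub> a') b c = \<gamma> a b c \<oplus>\<^bsub>P\<^esub> \<gamma> a' b c"
    and add2: "\<And>a b b' c. a \<in> carrier H \<Longrightarrow> b \<in> carrier H \<Longrightarrow> b' \<in> carrier H \<Longrightarrow> c \<in> carrier H
      \<Longrightarrow> \<gamma> a (b \<oplus>\<^bsub>H\<^esub> b') c = \<gamma> a b c \<oplus>\<^bsub>P\<^esub> \<gamma> a b' c"
    and add3: "\<And>a b c c'. a \<in> carrier H \<Longrightarrow> b \<in> carrier H \<Longrightarrow> c \<in> carrier H \<Longrightarrow> c' \<in> carrier H
      \<Longrightarrow> \<gamma> a b (c \<oplus>\<^bsub>H\<^esub> c') = \<gamma> a b c \<oplus>\<^bsub>P\<^esub> \<gamma> a b c'"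
    and smult12: "\<And>r a b c. r \<in> carrier k \<Longrightarrow> a \<in> carrier H \<Longrightarrow> b \<in> carrier H \<Longrightarrow> c \<in> carrier H
      \<Longrightarrow> \<gamma> (r \<odot>\<^bsub>H\<^esub> a) b c = \<gamma> a (r \<odot>\<^bsub>H\<^esub> b) c"
    and smult23: "\<And>r a b c. r \<in> carrier k \<Longrightarrow> a \<in> carrier H \<Longrightarrow> b \<in> carrier H \<Longrightarrow> c \<in> carrier H
      \<Longrightarrow> \<gamma> a (r \<odot>\<^bsub>H\<^esub> b) c = \<gamma> a b (r \<odot>\<^bsub>H\<^esub> c)"
  shows "sweedler P (\<lambda>a b. sweedler P (\<lambda>c d. \<gamma> c d b) a) h = sweedler P (\<lambda>a b. sweedler P (\<lambda>c d. \<gamma> a c d) b) h"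
proof -
  define \<Gamma> where "\<Gamma> a Y = tensor_lift P (\<lambda>c d. \<gamma> a c d) Y" for a Y
  have bal: "balanced k H H P (\<gamma> a)" if "a \<in> carrier H" for a
    unfolding balanced_def using that cl add2 add3 smult23 by simp
  have \<Gamma>_closed: "\<Gamma> a Y \<in> carrier P" if "a \<in> carrier H" "Y \<in> carrier HH.T" for a Y
    unfolding \<Gamma>_def using that cl by (intro HH.tensor_lift_closed[OF P]) auto
  have \<Gamma>_bal: "balanced k H HH.T P \<Gamma>"
    unfolding balanced_def
  proof (intro conjI ballI)
    fix a a' Y assume "a \<in> carrier H" "a' \<in> carrier H" "Y \<in> carrier HH.T"
    then show "\<Gamma> (a \<oplus>\<^bsub>H\<^esub> a') Y = \<Gamma> a Y \<oplus>\<^bsub>P\<^esub> \<Gamma> a' Y"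
      unfolding \<Gamma>_def using cl add1 abelian_monoid.a_closed[OF abelian_group.axioms(1)[OF P]]
      by (subst HH.tensor_lift_plus[OF P, symmetric]) (auto intro!: HH.tensor_lift_cong[OF P])
  next
    fix a Y Y' assume *: "a \<in> carrier H" "Y \<in> carrier HH.T" "Y' \<in> carrier HH.T"
    show "\<Gamma> a (Y \<oplus>\<^bsub>HH.T\<^esub> Y') = \<Gamma> a Y \<oplus>\<^bsub>P\<^esub> \<Gamma> a Y'"
      unfolding \<Gamma>_def by (rule tensor_lift_add[OF module_axioms module_axioms P bal[OF *(1)] *(2,3)])
  next
    fix r a Y assume *: "r \<in> carrier k" "a \<in> carrier H" "Y \<in> carrier HH.T"
    show "\<Gamma> (r \<odot>\<^bsub>H\<^esub> a) Y = \<Gamma> a (r \<odot>\<^bsub>HH.T\<^esub> Y)"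
      unfolding \<Gamma>_def HH.tensor_lift_smult[OF P bal[OF *(2)] *(3,1)] using * cl smult12
      by (intro HH.tensor_lift_cong[OF P]) auto
  qed (rule \<Gamma>_closed)
  define f where "f = tensor_lift P \<Gamma>"
  have f_pure: "f (pure_tensor k H HH.T a Y) = \<Gamma> a Y" if "a \<in> carrier H" "Y \<in> carrier HH.T" for a Y
    unfolding f_def by (rule tensor_lift_pure[OF module_axioms HH.module_tensor_product P \<Gamma>_bal that])
  have f_closed: "f X \<in> carrier P" if "X \<in> carrier HHH.T" for X
    unfolding f_def by (rule HHH.tensor_lift_closed[OF P that \<Gamma>_closed])
  have f_add: "f (X \<oplus>\<^bsub>HHH.T\<^esub> Y) = f X \<oplus>\<^bsub>P\<^esub> f Y" if "X \<in> carrier HHH.T" "Y \<in> carrier HHH.T" for X Y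
    unfolding f_def by (rule tensor_lift_add[OF module_axioms HH.module_tensor_product P \<Gamma>_bal that])
  note pc = HHH.pure_closed HH.pure_closed
  have f_sweedler: "f (sweedler HHH.T \<beta> x) = sweedler P (\<lambda>a b. f (\<beta> a b)) x"
    if "x \<in> carrier H" "\<And>a b. a \<in> carrier H \<Longrightarrow> b \<in> carrier H \<Longrightarrow> \<beta> a b \<in> carrier HHH.T" for x \<beta>
    by (rule sweedler_additive[OF HHH.T_abelian P that(1) f_closed f_add that(2)])
  have inner: "f (sweedler HHH.T (\<lambda>c d. pure_tensor k H HH.T c (pure_tensor k H H d b)) a)
      = sweedler P (\<lambda>c d. \<gamma> c d b) a" if "a \<in> carrier H" "b \<in> carrier H" for a b
  proof -
    have "f (pure_tensor k H HH.T c (pure_tensor k H H d b)) = \<gamma> c d b"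
      if "c \<in> carrier H" "d \<in> carrier H" for c d
      unfolding f_pure[OF that(1) HH.pure_closed[OF that(2) \<open>b \<in> carrier H\<close>]] \<Gamma>_def
      by (rule tensor_lift_pure[OF module_axioms module_axioms P bal]) (use that \<open>b \<in> carrier H\<close> in auto)
    then show ?thesis
      using that cl by (subst f_sweedler) (auto intro!: sweedler_cong[OF P] pc)
  qed
  have "sweedler P (\<lambda>a b. sweedler P (\<lambda>c d. \<gamma> c d b) a) h
    = sweedler P (\<lambda>a b. f (sweedler HHH.T (\<lambda>c d. pure_tensor k H HH.T c (pure_tensor k H H d b)) a)) h"
  proof (rule sweedler_cong[OF P h])
    fix a b assume ab: "a \<in> carrier H" "b \<in> carrier H"
    show "sweedler P (\<lambda>c d. \<gamma> c d b) a
      = f (sweedler HHH.T (\<lambda>c d. pure_tensor k H HH.T c (pure_tensor k H H d b)) a)"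
      by (rule inner[OF ab, symmetric])
    show "f (sweedler HHH.T (\<lambda>c d. pure_tensor k H HH.T c (pure_tensor k H H d b)) a) \<in> carrier P"
      unfolding inner[OF ab] using ab cl by (intro sweedler_closed[OF P]) auto
  qed
  also have "\<dots> = f (sweedler HHH.T (\<lambda>a b. sweedler HHH.T
      (\<lambda>c d. pure_tensor k H HH.T c (pure_tensor k H H d b)) a) h)"
    by (rule f_sweedler[symmetric, OF h]) (auto intro!: sweedler_closed HHH.T_abelian pc)
  also have "\<dots> = f (sweedler HHH.T (\<lambda>a b. pure_tensor k H HH.T a (\<Delta> b)) h)"
    by (simp only: coassoc[OF h])
  also have "\<dots> = sweedler P (\<lambda>a b. f (pure_tensor k H HH.T a (\<Delta> b))) h"
    by (rule f_sweedler[OF h]) (auto intro!: pc)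
  also have "\<dots> = sweedler P (\<lambda>a b. sweedler P (\<lambda>c d. \<gamma> a c d) b) h"
    using cl by (intro sweedler_cong[OF P h]) (auto simp: f_pure \<Gamma>_def intro!: sweedler_closed[OF P])
  finally show ?thesis .
qed

end

section \<open>The antipode and right integrals\<close>

context hopf_algebra
begin

text \<open>Insert \<open>\<Sum> S(b\<^sub>1) b\<^sub>2\<close>, which collapses by the antipode and counit axioms, on the left of
  \<open>\<Sum> a\<^sub>1 S(b a\<^sub>2)\<close>. By coassociativity and multiplicativity of \<open>\<Delta>\<close> the result is
  \<open>\<Sum> S(b\<^sub>1) (b\<^sub>2 a)\<^sub>1 S((b\<^sub>2 a)\<^sub>2) = \<Sum> S(b\<^sub>1) \<epsilon>(b\<^sub>2 a) = \<epsilon>(a) S(b)\<close>.\<close>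

lemma antipode_absorb:
  assumes a: "a \<in> carrier H" and b: "b \<in> carrier H"
  shows "sweedler H (\<lambda>c d. c \<otimes>\<^bsub>H\<^esub> S (b \<otimes>\<^bsub>H\<^esub> d)) a = \<epsilon> a \<odot>\<^bsub>H\<^esub> S b"
proof -
  note A = H_abelian
  define \<phi> where "\<phi> x = sweedler H (\<lambda>c d. c \<otimes>\<^bsub>H\<^esub> S (x \<otimes>\<^bsub>H\<^esub> d)) a" for x
  have \<phi>_closed: "\<phi> x \<in> carrier H" if "x \<in> carrier H" for x
    unfolding \<phi>_def using that by (intro sweedler_closed[OF A a]) simp
  have \<phi>_add: "\<phi> (x \<oplus>\<^bsub>H\<^esub> y) = \<phi> x \<oplus>\<^bsub>H\<^esub> \<phi> y" if "x \<in> carrier H" "y \<in> carrier H" for x y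
    unfolding \<phi>_def using that
    by (subst sweedler_plus[OF A a, symmetric]; (intro sweedler_cong[OF A a])?)
      (simp_all add: H.l_distr H.r_distr S_add)
  have \<phi>_smult: "\<phi> (r \<odot>\<^bsub>H\<^esub> x) = r \<odot>\<^bsub>H\<^esub> \<phi> x" if "r \<in> carrier k" "x \<in> carrier H" for r x
    unfolding \<phi>_def using that
    by (subst sweedler_additive[OF A A a, of "\<lambda>y. r \<odot>\<^bsub>H\<^esub> y"]; (intro sweedler_cong[OF A a])?)
      (simp_all add: smult_r_distr smult_mult_left smult_mult_right S_smult)
  have mul: "g \<otimes>\<^bsub>H\<^esub> sweedler H \<beta> x = sweedler H (\<lambda>c d. g \<otimes>\<^bsub>H\<^esub> \<beta> c d) x"
      "sweedler H \<beta> x \<otimes>\<^bsub>H\<^esub> g = sweedler H (\<lambda>c d. \<beta> c d \<otimes>\<^bsub>H\<^esub> g) x"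
    if "g \<in> carrier H" "x \<in> carrier H" "\<And>c d. c \<in> carrier H \<Longrightarrow> d \<in> carrier H \<Longrightarrow> \<beta> c d \<in> carrier H" for g x \<beta>
    using that
    by (intro sweedler_additive[OF A A, of _ "\<lambda>y. g \<otimes>\<^bsub>H\<^esub> y"] sweedler_additive[OF A A, of _ "\<lambda>y. y \<otimes>\<^bsub>H\<^esub> g"];
        simp add: H.r_distr H.l_distr)+
  have bal: "balanced k H H H (\<lambda>p q. p \<otimes>\<^bsub>H\<^esub> S q)"
    unfolding balanced_def
    by (simp add: H.l_distr H.r_distr S_add S_smult smult_mult_left smult_mult_right)
  \<comment> \<open>\<open>\<epsilon>(x)\<close> is replaced by \<open>\<Sum> S(x\<^sub>1) x\<^sub>2\<close>.\<close>
  have left: "\<phi> (\<epsilon> x \<odot>\<^bsub>H\<^esub> y) = sweedler H (\<lambda>p q. S p \<otimes>\<^bsub>H\<^esub> q \<otimes>\<^bsub>H\<^esub> \<phi> y) x"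
    if "x \<in> carrier H" "y \<in> carrier H" for x y
  proof -
    have "\<phi> (\<epsilon> x \<odot>\<^bsub>H\<^esub> y) = (\<epsilon> x \<odot>\<^bsub>H\<^esub> \<one>\<^bsub>H\<^esub>) \<otimes>\<^bsub>H\<^esub> \<phi> y"
      using that \<phi>_closed by (simp add: \<phi>_smult smult_mult_left)
    also have "\<dots> = sweedler H (\<lambda>p q. S p \<otimes>\<^bsub>H\<^esub> q \<otimes>\<^bsub>H\<^esub> \<phi> y) x"
      unfolding antipode_left[OF that(1), symmetric] using that \<phi>_closed by (intro mul(2)) simp_all
    finally show ?thesis .
  qed
  \<comment> \<open>The inner sums recombine to \<open>\<Sum> (y a)\<^sub>1 S((y a)\<^sub>2)\<close>.\<close>
  have right: "sweedler H (\<lambda>p q. S x \<otimes>\<^bsub>H\<^esub> p \<otimes>\<^bsub>H\<^esub> \<phi> q) y = \<epsilon> a \<odot>\<^bsub>H\<^esub> S (\<epsilon> y \<odot>\<^bsub>H\<^esub> x)"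
    if xy: "x \<in> carrier H" "y \<in> carrier H" for x y
  proof -
    have "sweedler H (\<lambda>p q. S x \<otimes>\<^bsub>H\<^esub> p \<otimes>\<^bsub>H\<^esub> \<phi> q) y
        = sweedler H (\<lambda>p q. S x \<otimes>\<^bsub>H\<^esub> sweedler H (\<lambda>c d. (p \<otimes>\<^bsub>H\<^esub> c) \<otimes>\<^bsub>H\<^esub> S (q \<otimes>\<^bsub>H\<^esub> d)) a) y"
    proof (rule sweedler_cong[OF A xy(2)])
      fix p q assume pq: "p \<in> carrier H" "q \<in> carrier H"
      have "p \<otimes>\<^bsub>H\<^esub> \<phi> q = sweedler H (\<lambda>c d. p \<otimes>\<^bsub>H\<^esub> (c \<otimes>\<^bsub>H\<^esub> S (q \<otimes>\<^bsub>H\<^esub> d))) a"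
        unfolding \<phi>_def using pq a by (intro mul(1)) simp_all
      also have "\<dots> = sweedler H (\<lambda>c d. (p \<otimes>\<^bsub>H\<^esub> c) \<otimes>\<^bsub>H\<^esub> S (q \<otimes>\<^bsub>H\<^esub> d)) a"
        using pq by (intro sweedler_cong[OF A a]) (simp_all add: H.m_assoc)
      finally show "S x \<otimes>\<^bsub>H\<^esub> p \<otimes>\<^bsub>H\<^esub> \<phi> q
        = S x \<otimes>\<^bsub>H\<^esub> sweedler H (\<lambda>c d. (p \<otimes>\<^bsub>H\<^esub> c) \<otimes>\<^bsub>H\<^esub> S (q \<otimes>\<^bsub>H\<^esub> d)) a"
        using pq xy \<phi>_closed by (simp add: H.m_assoc)
    qed (use a xy in \<open>auto intro!: H.m_closed sweedler_closed[OF A]\<close>)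
    also have "\<dots> = S x \<otimes>\<^bsub>H\<^esub> sweedler H (\<lambda>p q. p \<otimes>\<^bsub>H\<^esub> S q) (y \<otimes>\<^bsub>H\<^esub> a)"
      unfolding sweedler_mult[OF A bal xy(2) a] using a xy
      by (intro mul(1)[symmetric]) (auto intro!: sweedler_closed[OF A])
    also have "\<dots> = \<epsilon> a \<odot>\<^bsub>H\<^esub> S (\<epsilon> y \<odot>\<^bsub>H\<^esub> x)"
      using a xy
      by (simp add: antipode_right ring_hom_mult[OF \<epsilon>_hom] S_smult smult_mult_right smult_assoc1 R.m_comm)
    finally show ?thesis .
  qed
  have "sweedler H (\<lambda>c d. c \<otimes>\<^bsub>H\<^esub> S (b \<otimes>\<^bsub>H\<^esub> d)) a = \<phi> b"
    by (simp add: \<phi>_def)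
  also have "\<dots> = sweedler H (\<lambda>x y. \<phi> (\<epsilon> x \<odot>\<^bsub>H\<^esub> y)) b"
    by (rule sweedler_counit_left[OF A b \<phi>_closed \<phi>_add, symmetric])
  also have "\<dots> = sweedler H (\<lambda>x y. sweedler H (\<lambda>p q. S p \<otimes>\<^bsub>H\<^esub> q \<otimes>\<^bsub>H\<^esub> \<phi> y) x) b"
    by (rule sweedler_cong[OF A b left sweedler_closed[OF A]]) (simp_all add: \<phi>_closed)
  also have "\<dots> = sweedler H (\<lambda>x y. sweedler H (\<lambda>p q. S x \<otimes>\<^bsub>H\<^esub> p \<otimes>\<^bsub>H\<^esub> \<phi> q) y) b"
    by (rule sweedler_coassoc[OF A b])
      (simp_all add: \<phi>_closed \<phi>_add \<phi>_smult H.l_distr H.r_distr S_add S_smult smult_mult_left smult_mult_right)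
  also have "\<dots> = sweedler H (\<lambda>x y. \<epsilon> a \<odot>\<^bsub>H\<^esub> S (\<epsilon> y \<odot>\<^bsub>H\<^esub> x)) b"
    using a by (intro sweedler_cong[OF A b] right) simp_all
  also have "\<dots> = \<epsilon> a \<odot>\<^bsub>H\<^esub> S b"
    using a by (intro sweedler_counit_right[OF A b]) (simp_all add: S_add smult_r_distr)
  finally show ?thesis .
qed

text \<open>Write \<open>a\<close> as \<open>\<Sum> a\<^sub>1 \<epsilon>(a\<^sub>2)\<close> and use \<open>\<epsilon>(a\<^sub>2) t = t a\<^sub>2\<close>: the element \<open>\<Sum> a S(t\<^sub>1) \<otimes> t\<^sub>2\<close> becomes
  \<open>\<Sum> a\<^sub>1 S(t\<^sub>1 a\<^sub>2) \<otimes> t\<^sub>2 a\<^sub>3\<close>, and \<open>antipode_absorb\<close> reduces this to \<open>\<Sum> S(t\<^sub>1) \<otimes> t\<^sub>2 a\<close>. The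
  lemma tests this equality of tensors against an arbitrary balanced map.\<close>

lemma integral_casimir:
  assumes t: "right_integral H \<epsilon> t" and a: "a \<in> carrier H"
    and P: "abelian_group P" and bal: "balanced k H H P \<beta>"
  shows "sweedler P (\<lambda>p q. \<beta> (a \<otimes>\<^bsub>H\<^esub> S p) q) t = sweedler P (\<lambda>p q. \<beta> (S p) (q \<otimes>\<^bsub>H\<^esub> a)) t"
proof -
  have tH: "t \<in> carrier H" and t_mult: "\<And>h. h \<in> carrier H \<Longrightarrow> t \<otimes>\<^bsub>H\<^esub> h = \<epsilon> h \<odot>\<^bsub>H\<^esub> t"
    using t by (auto simp: right_integral_def)
  have cl [simp]: "\<beta> x y \<in> carrier P" if "x \<in> carrier H" "y \<in> carrier H" for x y
    using bal that unfolding balanced_def by blast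
  have add1: "\<beta> (x \<oplus>\<^bsub>H\<^esub> x') y = \<beta> x y \<oplus>\<^bsub>P\<^esub> \<beta> x' y"
    if "x \<in> carrier H" "x' \<in> carrier H" "y \<in> carrier H" for x x' y
    using bal that unfolding balanced_def by blast
  have add2: "\<beta> x (y \<oplus>\<^bsub>H\<^esub> y') = \<beta> x y \<oplus>\<^bsub>P\<^esub> \<beta> x y'"
    if "x \<in> carrier H" "y \<in> carrier H" "y' \<in> carrier H" for x y y'
    using bal that unfolding balanced_def by blast
  have smult: "\<beta> (r \<odot>\<^bsub>H\<^esub> x) y = \<beta> x (r \<odot>\<^bsub>H\<^esub> y)"
    if "r \<in> carrier k" "x \<in> carrier H" "y \<in> carrier H" for r x y
    using bal that unfolding balanced_def by blast
  have bal': "balanced k H H P (\<lambda>p q. \<beta> (x \<otimes>\<^bsub>H\<^esub> S p) q)" if "x \<in> carrier H" for x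
    unfolding balanced_def using that
    by (simp add: H.r_distr S_add S_smult smult_mult_right add1 add2 smult)
  let ?g = "\<lambda>x y z p q. \<beta> (x \<otimes>\<^bsub>H\<^esub> S (p \<otimes>\<^bsub>H\<^esub> y)) (q \<otimes>\<^bsub>H\<^esub> z)"
  \<comment> \<open>Expansion of \<open>a\<close> by the counit axiom.\<close>
  have unit: "sweedler P (\<lambda>x y. \<beta> (\<epsilon> y \<odot>\<^bsub>H\<^esub> x \<otimes>\<^bsub>H\<^esub> S p) q) a = \<beta> (a \<otimes>\<^bsub>H\<^esub> S p) q"
    if "p \<in> carrier H" "q \<in> carrier H" for p q
    using that by (intro sweedler_counit_right[OF P a, of "\<lambda>x. \<beta> (x \<otimes>\<^bsub>H\<^esub> S p) q"]) (simp_all add: H.l_distr add1)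
  \<comment> \<open>The integral property, used backwards: \<open>\<epsilon>(y) t = t y\<close>.\<close>
  have absorb: "sweedler P (\<lambda>p q. \<beta> (\<epsilon> y \<odot>\<^bsub>H\<^esub> x \<otimes>\<^bsub>H\<^esub> S p) q) t
      = sweedler P (\<lambda>p q. sweedler P (\<lambda>c d. ?g x c d p q) y) t"
    if xy: "x \<in> carrier H" "y \<in> carrier H" for x y
  proof -
    have "sweedler P (\<lambda>p q. \<beta> (\<epsilon> y \<odot>\<^bsub>H\<^esub> x \<otimes>\<^bsub>H\<^esub> S p) q) t
       = sweedler P (\<lambda>p q. \<beta> (x \<otimes>\<^bsub>H\<^esub> S (\<epsilon> y \<odot>\<^bsub>H\<^esub> p)) q) t"
      using xy by (intro sweedler_cong[OF P tH]) (simp_all add: S_smult smult_mult_left smult_mult_right)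
    also have "\<dots> = sweedler P (\<lambda>p q. \<beta> (x \<otimes>\<^bsub>H\<^esub> S p) q) (t \<otimes>\<^bsub>H\<^esub> y)"
      unfolding t_mult[OF xy(2)] using xy by (intro sweedler_smult[OF P bal' _ tH, symmetric]) simp_all
    also have "\<dots> = sweedler P (\<lambda>p q. sweedler P (\<lambda>c d. ?g x c d p q) y) t"
      by (rule sweedler_mult[OF P bal'[OF xy(1)] tH xy(2)])
    finally show ?thesis .
  qed
  have antipode: "sweedler P (\<lambda>c d. ?g c d y p q) x = \<beta> (S p) (q \<otimes>\<^bsub>H\<^esub> (\<epsilon> x \<odot>\<^bsub>H\<^esub> y))"
    if "x \<in> carrier H" "y \<in> carrier H" "p \<in> carrier H" "q \<in> carrier H" for x y p q
  proof -
    have "sweedler P (\<lambda>c d. ?g c d y p q) x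
      = \<beta> (sweedler H (\<lambda>c d. c \<otimes>\<^bsub>H\<^esub> S (p \<otimes>\<^bsub>H\<^esub> d)) x) (q \<otimes>\<^bsub>H\<^esub> y)"
      using that by (intro sweedler_additive[OF H_abelian P, of _ "\<lambda>z. \<beta> z (q \<otimes>\<^bsub>H\<^esub> y)", symmetric])
        (simp_all add: add1)
    then show ?thesis
      using that by (simp add: antipode_absorb smult smult_mult_right)
  qed
  have "sweedler P (\<lambda>p q. \<beta> (a \<otimes>\<^bsub>H\<^esub> S p) q) t
    = sweedler P (\<lambda>p q. sweedler P (\<lambda>x y. \<beta> (\<epsilon> y \<odot>\<^bsub>H\<^esub> x \<otimes>\<^bsub>H\<^esub> S p) q) a) t"
    using a by (intro sweedler_cong[OF P tH] unit[symmetric]) (auto intro!: sweedler_closed[OF P])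
  also have "\<dots> = sweedler P (\<lambda>x y. sweedler P (\<lambda>p q. \<beta> (\<epsilon> y \<odot>\<^bsub>H\<^esub> x \<otimes>\<^bsub>H\<^esub> S p) q) t) a"
    by (rule sweedler_swap[OF P tH a]) simp
  also have "\<dots> = sweedler P (\<lambda>x y. sweedler P (\<lambda>p q. sweedler P (\<lambda>c d. ?g x c d p q) y) t) a"
    using tH P by (intro sweedler_cong[OF P a] absorb) (auto intro!: sweedler_closed)
  also have "\<dots> = sweedler P (\<lambda>p q. sweedler P (\<lambda>x y. sweedler P (\<lambda>c d. ?g x c d p q) y) a) t"
    using P by (intro sweedler_swap[OF P a tH]) (auto intro!: sweedler_closed)
  also have "\<dots> = sweedler P (\<lambda>p q. sweedler P (\<lambda>x y. sweedler P (\<lambda>c d. ?g c d y p q) x) a) t"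
  proof (intro sweedler_cong[OF P tH])
    fix p q assume pq: "p \<in> carrier H" "q \<in> carrier H"
    show "sweedler P (\<lambda>x y. sweedler P (\<lambda>c d. ?g x c d p q) y) a
        = sweedler P (\<lambda>x y. sweedler P (\<lambda>c d. ?g c d y p q) x) a"
      by (rule sweedler_coassoc[OF P a, symmetric])
        (use pq in \<open>simp_all add: H.l_distr H.r_distr S_add S_smult smult_mult_left smult_mult_right add1 add2 smult\<close>)
  qed (use a P in \<open>auto intro!: sweedler_closed\<close>)
  also have "\<dots> = sweedler P (\<lambda>p q. sweedler P (\<lambda>x y. \<beta> (S p) (q \<otimes>\<^bsub>H\<^esub> (\<epsilon> x \<odot>\<^bsub>H\<^esub> y))) a) t"
    using a P by (intro sweedler_cong[OF P tH] sweedler_cong[OF P a] antipode) (auto intro!: sweedler_closed)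
  also have "\<dots> = sweedler P (\<lambda>p q. \<beta> (S p) (q \<otimes>\<^bsub>H\<^esub> a)) t"
  proof (intro sweedler_cong[OF P tH])
    fix p q assume "p \<in> carrier H" "q \<in> carrier H"
    then show "sweedler P (\<lambda>x y. \<beta> (S p) (q \<otimes>\<^bsub>H\<^esub> (\<epsilon> x \<odot>\<^bsub>H\<^esub> y))) a = \<beta> (S p) (q \<otimes>\<^bsub>H\<^esub> a)"
      by (intro sweedler_counit_left[OF P a, of "\<lambda>z. \<beta> (S p) (q \<otimes>\<^bsub>H\<^esub> z)"]) (simp_all add: H.r_distr add2)
  qed (use a in simp)
  finally show ?thesis .
qed

end

section \<open>Separable functors\<close>

lemma separable_functorE:
  assumes "separable_functor C D F"
  obtains \<P> where "\<And>X Y h. \<lbrakk>X \<in> Obj C; Y \<in> Obj C; h \<in> Arr D (FObj F X) (FObj F Y)\<rbrakk> \<Longrightarrow> \<P> X Y h \<in> Arr C X Y"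
    and "\<And>X Y Z T u v h. \<lbrakk>X \<in> Obj C; Y \<in> Obj C; Z \<in> Obj C; T \<in> Obj C;
        u \<in> Arr C X Y; v \<in> Arr C Z T; h \<in> Arr D (FObj F Y) (FObj F Z)\<rbrakk> \<Longrightarrow>
        \<P> X T (Comp D (FObj F X) (FObj F Z) (FObj F T) (FArr F Z T v)
                 (Comp D (FObj F X) (FObj F Y) (FObj F Z) h (FArr F X Y u)))
         = Comp C X Z T v (Comp C X Y Z (\<P> Y Z h) u)"
    and "\<And>X Y f. \<lbrakk>X \<in> Obj C; Y \<in> Obj C; f \<in> Arr C X Y\<rbrakk> \<Longrightarrow> \<P> X Y (FArr F X Y f) = f"
proof -
  from assms[unfolded separable_functor_def] show ?thesis
  proof (elim exE conjE)
    fix \<P>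
    assume "\<forall>X\<in>Obj C. \<forall>Y\<in>Obj C. \<forall>h\<in>Arr D (FObj F X) (FObj F Y). \<P> X Y h \<in> Arr C X Y"
      "\<forall>X\<in>Obj C. \<forall>Y\<in>Obj C. \<forall>Z\<in>Obj C. \<forall>T\<in>Obj C.
       \<forall>u\<in>Arr C X Y. \<forall>v\<in>Arr C Z T. \<forall>h\<in>Arr D (FObj F Y) (FObj F Z).
         \<P> X T (Comp D (FObj F X) (FObj F Z) (FObj F T) (FArr F Z T v)
                 (Comp D (FObj F X) (FObj F Y) (FObj F Z) h (FArr F X Y u)))
         = Comp C X Z T v (Comp C X Y Z (\<P> Y Z h) u)"
      "\<forall>X\<in>Obj C. \<forall>Y\<in>Obj C. \<forall>f\<in>Arr C X Y. \<P> X Y (FArr F X Y f) = f"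
    then show ?thesis
      by (intro that[of \<P>]) simp_all
  qed
qed

context is_functor
begin

text \<open>If \<open>s\<close> is a right inverse of \<open>F p\<close>, naturality of \<open>\<P>\<close> makes \<open>\<P> s\<close> a right inverse of \<open>p\<close>, through which
  every \<open>f\<close> lifts. The proof for left inverses is dual.\<close>

lemma separable_imp_dual_maschke:
  assumes "separable_functor C D F"
  shows "dual_maschke_functor C D F"
proof -
  from assms obtain \<P> where \<P>: "\<And>X Y h. \<lbrakk>X \<in> Obj C; Y \<in> Obj C; h \<in> Arr D (FObj F X) (FObj F Y)\<rbrakk> \<Longrightarrow> \<P> X Y h \<in> Arr C X Y"
    and nat: "\<And>X Y Z T u v h. \<lbrakk>X \<in> Obj C; Y \<in> Obj C; Z \<in> Obj C; T \<in> Obj C;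
        u \<in> Arr C X Y; v \<in> Arr C Z T; h \<in> Arr D (FObj F Y) (FObj F Z)\<rbrakk> \<Longrightarrow>
        \<P> X T (Comp D (FObj F X) (FObj F Z) (FObj F T) (FArr F Z T v)
                 (Comp D (FObj F X) (FObj F Y) (FObj F Z) h (FArr F X Y u)))
         = Comp C X Z T v (Comp C X Y Z (\<P> Y Z h) u)"
    and id: "\<And>X Y f. \<lbrakk>X \<in> Obj C; Y \<in> Obj C; f \<in> Arr C X Y\<rbrakk> \<Longrightarrow> \<P> X Y (FArr F X Y f) = f"
    by (rule separable_functorE) blast
  show ?thesis
    unfolding dual_maschke_functor_def relative_projective_def
  proof (intro ballI impI)
    fix A Y X p f
    assume A: "A \<in> Obj C" and Y: "Y \<in> Obj C" and X: "X \<in> Obj C" and p: "p \<in> Arr C Y X" and f: "f \<in> Arr C A X"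
      and "has_right_inverse D (FObj F Y) (FObj F X) (FArr F Y X p)"
    then obtain s where s: "s \<in> Arr D (FObj F X) (FObj F Y)"
      and ps: "Comp D (FObj F X) (FObj F Y) (FObj F X) (FArr F Y X p) s = Ident D (FObj F X)"
      by (auto simp: has_right_inverse_def)
    have "Comp C X Y X p (Comp C X X Y (\<P> X Y s) (Ident C X)) = \<P> X X (Ident D (FObj F X))"
      using nat[OF X X Y X src.Ident_in[OF X] p s] s ps X Y by (simp add: FArr_Ident tgt.Comp_Ident FObj_in)
    also have "\<dots> = Ident C X"
      using id[OF X X src.Ident_in[OF X]] X by (simp add: FArr_Ident)
    finally have "Comp C X Y X p (\<P> X Y s) = Ident C X"
      using src.Comp_Ident[OF X Y \<P>[OF X Y s]] by simp
    then have "f = Comp C A Y X p (Comp C A X Y (\<P> X Y s) f)"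
      using src.Comp_assoc[OF A X Y X f \<P>[OF X Y s] p] src.Ident_Comp[OF A X f] by simp
    moreover have "Comp C A X Y (\<P> X Y s) f \<in> Arr C A Y"
      by (rule src.Comp_in[OF A X Y f \<P>[OF X Y s]])
    ultimately show "\<exists>g\<in>Arr C A Y. f = Comp C A Y X p g"
      by blast
  qed
qed

lemma separable_imp_maschke:
  assumes "separable_functor C D F"
  shows "maschke_functor C D F"
proof -
  from assms obtain \<P> where \<P>: "\<And>X Y h. \<lbrakk>X \<in> Obj C; Y \<in> Obj C; h \<in> Arr D (FObj F X) (FObj F Y)\<rbrakk> \<Longrightarrow> \<P> X Y h \<in> Arr C X Y"
    and nat: "\<And>X Y Z T u v h. \<lbrakk>X \<in> Obj C; Y \<in> Obj C; Z \<in> Obj C; T \<in> Obj C;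
        u \<in> Arr C X Y; v \<in> Arr C Z T; h \<in> Arr D (FObj F Y) (FObj F Z)\<rbrakk> \<Longrightarrow>
        \<P> X T (Comp D (FObj F X) (FObj F Z) (FObj F T) (FArr F Z T v)
                 (Comp D (FObj F X) (FObj F Y) (FObj F Z) h (FArr F X Y u)))
         = Comp C X Z T v (Comp C X Y Z (\<P> Y Z h) u)"
    and id: "\<And>X Y f. \<lbrakk>X \<in> Obj C; Y \<in> Obj C; f \<in> Arr C X Y\<rbrakk> \<Longrightarrow> \<P> X Y (FArr F X Y f) = f"
    by (rule separable_functorE) blast
  show ?thesis
    unfolding maschke_functor_def relative_injective_def
  proof (intro ballI impI)
    fix M X Y i f
    assume M: "M \<in> Obj C" and X: "X \<in> Obj C" and Y: "Y \<in> Obj C" and i: "i \<in> Arr C X Y" and f: "f \<in> Arr C X M"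
      and "has_left_inverse D (FObj F X) (FObj F Y) (FArr F X Y i)"
    then obtain r where r: "r \<in> Arr D (FObj F Y) (FObj F X)"
      and ri: "Comp D (FObj F X) (FObj F Y) (FObj F X) r (FArr F X Y i) = Ident D (FObj F X)"
      by (auto simp: has_left_inverse_def)
    have "Comp C X X X (Ident C X) (Comp C X Y X (\<P> Y X r) i) = \<P> X X (Ident D (FObj F X))"
      using nat[OF X Y X X i src.Ident_in[OF X] r] r ri X Y
      by (simp add: FArr_Ident tgt.Comp_Ident FObj_in tgt.Ident_in)
    also have "\<dots> = Ident C X"
      using id[OF X X src.Ident_in[OF X]] X by (simp add: FArr_Ident)
    finally have "Comp C X Y X (\<P> Y X r) i = Ident C X"
      using src.Ident_Comp[OF X X src.Comp_in[OF X Y X i \<P>[OF Y X r]]] by simp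
    then have "f = Comp C X Y M (Comp C Y X M f (\<P> Y X r)) i"
      using src.Comp_assoc[OF X Y X M i \<P>[OF Y X r] f] src.Comp_Ident[OF X M f] by simp
    moreover have "Comp C Y X M f (\<P> Y X r) \<in> Arr C Y M"
      by (rule src.Comp_in[OF Y X M \<P>[OF Y X r] f])
    ultimately show "\<exists>g\<in>Arr C Y M. f = Comp C X Y M g i"
      by blast
  qed
qed

text \<open>Splitness is stated through a right inverse of \<open>p\<close>, so lifting the identity of \<open>Z\<close> along \<open>p\<close> suffices.\<close>

lemma dual_maschke_imp_semisimple:
  assumes "dual_maschke_functor C D F"
  shows "semisimple_functor C D F"
  unfolding semisimple_functor_def
proof (intro allI impI)
  fix X Y Z i p
  assume *: "short_exact C X Y Z i p \<and>
    split_exact D (FObj F X) (FObj F Y) (FObj F Z) (FArr F X Y i) (FArr F Y Z p)"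
  then have Y: "Y \<in> Obj C" and Z: "Z \<in> Obj C" and p: "p \<in> Arr C Y Z"
    and s: "has_right_inverse D (FObj F Y) (FObj F Z) (FArr F Y Z p)"
    by (auto simp: short_exact_def split_exact_def)
  have "\<exists>g\<in>Arr C Z Y. Ident C Z = Comp C Z Y Z p g"
    using assms Y Z p s src.Ident_in[OF Z] unfolding dual_maschke_functor_def relative_projective_def by blast
  then have "has_right_inverse C Y Z p"
    unfolding has_right_inverse_def by metis
  with * show "split_exact C X Y Z i p"
    by (simp add: split_exact_def)
qed

end

section \<open>Short exact sequences of modules\<close>

lemma right_module_homI:
  assumes "f \<in> extensional (carrier M)" "\<And>x. x \<in> carrier M \<Longrightarrow> f x \<in> carrier N"
    and "\<And>x y. x \<in> carrier M \<Longrightarrow> y \<in> carrier M \<Longrightarrow> f (x \<oplus>\<^bsub>M\<^esub> y) = f x \<oplus>\<^bsub>N\<^esub> f y"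
    and "\<And>a x. a \<in> carrier R \<Longrightarrow> x \<in> carrier M \<Longrightarrow> f (a \<odot>\<^bsub>M\<^esub> x) = a \<odot>\<^bsub>N\<^esub> f x"
  shows "f \<in> right_module_hom R M N"
  using assms unfolding right_module_hom_def by (auto simp: PiE_def)

lemma right_module_homD:
  assumes "f \<in> right_module_hom R M N"
  shows "f \<in> extensional (carrier M)" "x \<in> carrier M \<Longrightarrow> f x \<in> carrier N"
    and "x \<in> carrier M \<Longrightarrow> y \<in> carrier M \<Longrightarrow> f (x \<oplus>\<^bsub>M\<^esub> y) = f x \<oplus>\<^bsub>N\<^esub> f y"
    and "a \<in> carrier R \<Longrightarrow> x \<in> carrier M \<Longrightarrow> f (a \<odot>\<^bsub>M\<^esub> x) = a \<odot>\<^bsub>N\<^esub> f x"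
  using assms unfolding right_module_hom_def by (auto simp: PiE_def Pi_def)

lemma right_module_hom_eqI:
  assumes "f \<in> right_module_hom R M N" "g \<in> right_module_hom R M N" "\<And>x. x \<in> carrier M \<Longrightarrow> f x = g x"
  shows "f = g"
  using assms by (metis extensionalityI right_module_homD(1))

lemma right_module_hom_zero:
  assumes "right_module R M" "right_module R N" "f \<in> right_module_hom R M N"
  shows "f \<zero>\<^bsub>M\<^esub> = \<zero>\<^bsub>N\<^esub>"
proof -
  interpret M: right_module R M by fact
  interpret N: right_module R N by fact
  have z: "f \<zero>\<^bsub>M\<^esub> \<in> carrier N"
    using right_module_homD(2)[OF assms(3)] by simp
  have "f \<zero>\<^bsub>M\<^esub> \<oplus>\<^bsub>N\<^esub> f \<zero>\<^bsub>M\<^esub> = f \<zero>\<^bsub>M\<^esub>"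
    using right_module_homD(3)[OF assms(3), of "\<zero>\<^bsub>M\<^esub>" "\<zero>\<^bsub>M\<^esub>"] by simp
  then show ?thesis
    using z by (metis N.M.add.r_cancel_one)
qed

lemma compose_hom:
  assumes "right_module R M" and f: "f \<in> right_module_hom R M N" and g: "g \<in> right_module_hom R N P"
  shows "compose (carrier M) g f \<in> right_module_hom R M P"
proof -
  interpret M: right_module R M by fact
  show ?thesis
    by (rule right_module_homI)
      (simp_all add: compose_def M.act_closed right_module_homD[OF f] right_module_homD[OF g])
qed

definition zero_module :: "'u \<Rightarrow> ('a, 'u) module" where
  "zero_module z = \<lparr>carrier = {z}, monoid.mult = undefined, one = undefined, ring.zero = z,
     add = (\<lambda>x y. z), smult = (\<lambda>a x. z)\<rparr>"

lemma right_module_zero_module: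
  assumes "ring R"
  shows "right_module R (zero_module z)"
proof -
  have "abelian_group (zero_module z)"
    by (rule abelian_groupI) (auto simp: zero_module_def)
  then show ?thesis
    using assms by (intro right_module.intro right_module_axioms.intro) (auto simp: zero_module_def)
qed

lemma Obj_right_module_cat [simp]: "M \<in> Obj (right_module_cat R) \<longleftrightarrow> right_module R M"
  and Arr_right_module_cat [simp]: "Arr (right_module_cat R) = right_module_hom R"
  and Comp_right_module_cat [simp]: "Comp (right_module_cat R) X Y Z g f = compose (carrier X) g f"
  and Ident_right_module_cat [simp]: "Ident (right_module_cat R) X = (\<lambda>x\<in>carrier X. x)"
  by (simp_all add: right_module_cat_def)

lemma hom_const_zero:
  assumes "right_module R M" "right_module R N"
  shows "(\<lambda>x\<in>carrier M. \<zero>\<^bsub>N\<^esub>) \<in> right_module_hom R M N"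
proof -
  interpret M: right_module R M by fact
  interpret N: right_module R N by fact
  have "a \<odot>\<^bsub>N\<^esub> \<zero>\<^bsub>N\<^esub> = \<zero>\<^bsub>N\<^esub>" if "a \<in> carrier R" for a
    using N.act_distr[OF that N.M.zero_closed N.M.zero_closed] N.act_closed[OF that N.M.zero_closed]
    by (metis N.M.add.r_cancel_one N.M.l_zero N.M.zero_closed)
  then show ?thesis
    by (intro right_module_homI) (auto simp: M.act_closed)
qed

lemma zero_object_right_module_cat:
  fixes R :: "('a, 'r) ring_scheme" and z :: 'u
  assumes "ring R"
  shows "zero_object (right_module_cat R) (zero_module z)"
  unfolding zero_object_def
proof (intro conjI ballI)
  note Z = right_module_zero_module[OF assms, of z]
  show "zero_module z \<in> Obj (right_module_cat R)"
    using Z by simp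
  fix X :: "('a, 'u) module" assume "X \<in> Obj (right_module_cat R)"
  then have X: "right_module R X" by simp
  have "f x = z" if "f \<in> right_module_hom R X (zero_module z)" "x \<in> carrier X" for f x
    using right_module_homD(2)[OF that] by (simp add: zero_module_def)
  then show "\<exists>!f. f \<in> Arr (right_module_cat R) X (zero_module z)"
    using hom_const_zero[OF X Z] by (intro ex1I) (auto intro!: right_module_hom_eqI simp: zero_module_def)
  have "f x = \<zero>\<^bsub>X\<^esub>" if "f \<in> right_module_hom R (zero_module z) X" "x \<in> carrier (zero_module z)" for f x
    using right_module_hom_zero[OF Z X that(1)] that(2) by (simp add: zero_module_def)
  then show "\<exists>!f. f \<in> Arr (right_module_cat R) (zero_module z) X"
    using hom_const_zero[OF Z X] by (intro ex1I) (auto intro!: right_module_hom_eqI)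
qed

text \<open>A categorical zero object of modules has only the zero map into it, so an arrow that factors
  through one vanishes; conversely a vanishing map factors through a one-element module.\<close>

lemma zero_arrow_right_module_cat:
  fixes X Y :: "('a, 'u) module"
  assumes X: "right_module R X" and Y: "right_module R Y" and f: "f \<in> right_module_hom R X Y"
  shows "zero_arrow (right_module_cat R) X Y f \<longleftrightarrow> (\<forall>x\<in>carrier X. f x = \<zero>\<^bsub>Y\<^esub>)"
proof
  assume "zero_arrow (right_module_cat R) X Y f"
  then obtain Z :: "('a, 'u) module" and g h where Z: "zero_object (right_module_cat R) Z"
    and g: "g \<in> right_module_hom R X Z" and h: "h \<in> right_module_hom R Z Y"
    and fgh: "f = compose (carrier X) h g"
    unfolding zero_arrow_def Arr_right_module_cat Comp_right_module_cat by blast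
  have RZ: "right_module R Z" and uniq: "\<exists>!f. f \<in> right_module_hom R X Z"
    using Z X by (auto simp: zero_object_def)
  have "g = (\<lambda>x\<in>carrier X. \<zero>\<^bsub>Z\<^esub>)"
    using uniq g hom_const_zero[OF X RZ] by blast
  then show "\<forall>x\<in>carrier X. f x = \<zero>\<^bsub>Y\<^esub>"
    using right_module_hom_zero[OF RZ Y h] by (simp add: fgh compose_def)
next
  assume 0: "\<forall>x\<in>carrier X. f x = \<zero>\<^bsub>Y\<^esub>"
  have R: "ring R" using X by (rule right_module.axioms(1))
  let ?Z = "zero_module undefined :: ('a, 'u) module"
  have Z: "right_module R ?Z"
    by (rule right_module_zero_module[OF R])
  have "f = compose (carrier X) (\<lambda>x\<in>carrier ?Z. \<zero>\<^bsub>Y\<^esub>) (\<lambda>x\<in>carrier X. \<zero>\<^bsub>?Z\<^esub>)"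
    using 0 by (intro right_module_hom_eqI[OF f compose_hom[OF X hom_const_zero[OF X Z] hom_const_zero[OF Z Y]]])
      (simp add: compose_def zero_module_def)
  then show "zero_arrow (right_module_cat R) X Y f"
    unfolding zero_arrow_def Arr_right_module_cat Comp_right_module_cat
    by (intro exI[of _ ?Z] conjI bexI) (rule zero_object_right_module_cat[OF R] hom_const_zero X Y Z | assumption)+
qed

text \<open>The usual elementwise notion of exactness implies the categorical one: an arrow killed by \<open>p\<close> is
  lifted through the injection \<open>i\<close>, and an arrow that kills the image of \<open>i\<close> is constant on the fibres
  of the surjection \<open>p\<close>.\<close>

lemma short_exact_right_module_cat:
  fixes X Y Z :: "('a, 'u) module"
  assumes X: "right_module R X" and Y: "right_module R Y" and Z: "right_module R Z"
    and i: "i \<in> right_module_hom R X Y" and p: "p \<in> right_module_hom R Y Z"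
    and inj: "inj_on i (carrier X)" and surj: "p ` carrier Y = carrier Z"
    and exact: "{y \<in> carrier Y. p y = \<zero>\<^bsub>Z\<^esub>} = i ` carrier X"
  shows "short_exact (right_module_cat R) X Y Z i p"
proof -
  interpret X: right_module R X by fact
  interpret Y: right_module R Y by fact
  interpret Z: right_module R Z by fact
  note i' = right_module_homD[OF i] and p' = right_module_homD[OF p]
  have pi: "zero_arrow (right_module_cat R) X Z (compose (carrier X) p i)"
    unfolding zero_arrow_right_module_cat[OF X Z compose_hom[OF X i p]]
    using exact by (auto simp: compose_def)
  have "is_kernel (right_module_cat R) X Y Z i p"
    unfolding is_kernel_def Comp_right_module_cat
  proof (intro conjI ballI impI pi)
    fix T :: "('a, 'u) module" and f
    assume "T \<in> Obj (right_module_cat R)" "f \<in> Arr (right_module_cat R) T Y"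
    then have T: "right_module R T" and f: "f \<in> right_module_hom R T Y" by simp_all
    interpret T: right_module R T by fact
    note f' = right_module_homD[OF f]
    assume "zero_arrow (right_module_cat R) T Z (compose (carrier T) p f)"
    then have "\<forall>x\<in>carrier T. p (f x) = \<zero>\<^bsub>Z\<^esub>"
      unfolding zero_arrow_right_module_cat[OF T Z compose_hom[OF T f p]] by (simp add: compose_def)
    then have "f x \<in> i ` carrier X" if "x \<in> carrier T" for x
      using that f'(2) exact by blast
    then obtain g where g: "\<And>x. x \<in> carrier T \<Longrightarrow> g x \<in> carrier X \<and> i (g x) = f x"
      unfolding image_iff by metis
    have eqX: "x = y" if "i x = i y" "x \<in> carrier X" "y \<in> carrier X" for x y
      using inj that by (auto simp: inj_on_def)
    have "restrict g (carrier T) \<in> right_module_hom R T X"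
    proof (rule right_module_homI)
      fix x y assume "x \<in> carrier T" "y \<in> carrier T"
      then show "restrict g (carrier T) (x \<oplus>\<^bsub>T\<^esub> y) = restrict g (carrier T) x \<oplus>\<^bsub>X\<^esub> restrict g (carrier T) y"
        using g by - (rule eqX, simp_all add: i' f')
    next
      fix a x assume "a \<in> carrier R" "x \<in> carrier T"
      then show "restrict g (carrier T) (a \<odot>\<^bsub>T\<^esub> x) = a \<odot>\<^bsub>X\<^esub> restrict g (carrier T) x"
        using g by - (rule eqX, simp_all add: i' f' T.act_closed X.act_closed)
    qed (use g in auto)
    moreover have "compose (carrier T) i (restrict g (carrier T)) = f"
      using g f'(1) by (intro extensionalityI[of _ "carrier T"]) (auto simp: compose_def)
    moreover have "h = h'" if "h \<in> right_module_hom R T X" "h' \<in> right_module_hom R T X"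
        "compose (carrier T) i h = compose (carrier T) i h'" for h h'
    proof (rule right_module_hom_eqI[OF that(1,2)])
      fix x assume x: "x \<in> carrier T"
      then have "i (h x) = i (h' x)"
        using fun_cong[OF that(3), of x] by (simp add: compose_def)
      then show "h x = h' x"
        using right_module_homD(2)[OF that(1) x] right_module_homD(2)[OF that(2) x] by (rule eqX)
    qed
    ultimately show "\<exists>!g. g \<in> Arr (right_module_cat R) T X \<and> compose (carrier T) i g = f"
      by (intro ex1I[of _ "restrict g (carrier T)"]) auto
  qed
  moreover have "is_cokernel (right_module_cat R) X Y Z i p"
    unfolding is_cokernel_def Comp_right_module_cat
  proof (intro conjI ballI impI pi)
    fix T :: "('a, 'u) module" and f
    assume "T \<in> Obj (right_module_cat R)" "f \<in> Arr (right_module_cat R) Y T"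
    then have T: "right_module R T" and f: "f \<in> right_module_hom R Y T" by simp_all
    interpret T: right_module R T by fact
    note f' = right_module_homD[OF f]
    assume "zero_arrow (right_module_cat R) X T (compose (carrier X) f i)"
    then have fi: "f y = \<zero>\<^bsub>T\<^esub>" if "y \<in> i ` carrier X" for y
      using that unfolding zero_arrow_right_module_cat[OF X T compose_hom[OF X i f]] by (auto simp: compose_def)
    have f_eq: "f y = f y'" if "y \<in> carrier Y" "y' \<in> carrier Y" "p y = p y'" for y y'
    proof -
      let ?d = "y \<ominus>\<^bsub>Y\<^esub> y'"
      have d: "?d \<in> carrier Y" "?d \<oplus>\<^bsub>Y\<^esub> y' = y"
        using that by (simp_all add: Y.M.minus_eq Y.M.a_assoc Y.M.l_neg)
      have "p ?d \<oplus>\<^bsub>Z\<^esub> p y' = p y'"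
        using p'(3)[OF d(1) that(2)] that d by simp
      then have "p ?d = \<zero>\<^bsub>Z\<^esub>"
        using p'(2)[OF d(1)] p'(2)[OF that(2)] Z.M.add.r_cancel_one[of "p y'" "p ?d"] by simp
      then have "f ?d = \<zero>\<^bsub>T\<^esub>"
        using d exact by (intro fi) blast
      then show ?thesis
        using f'(3)[OF d(1) that(2)] f'(2)[OF that(2)] d by simp
    qed
    let ?s = "inv_into (carrier Y) p"
    have s: "?s z \<in> carrier Y \<and> p (?s z) = z" if "z \<in> carrier Z" for z
      using that surj by (auto simp: inv_into_into f_inv_into_f)
    let ?g = "\<lambda>z\<in>carrier Z. f (?s z)"
    have "?g \<in> right_module_hom R Z T"
    proof (rule right_module_homI)
      fix x y assume "x \<in> carrier Z" "y \<in> carrier Z"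
      then show "?g (x \<oplus>\<^bsub>Z\<^esub> y) = ?g x \<oplus>\<^bsub>T\<^esub> ?g y"
        using s by (simp add: f'(3)[symmetric]) (rule f_eq, simp_all add: p')
    next
      fix a x assume "a \<in> carrier R" "x \<in> carrier Z"
      then show "?g (a \<odot>\<^bsub>Z\<^esub> x) = a \<odot>\<^bsub>T\<^esub> ?g x"
        using s by (simp add: Z.act_closed f'(4)[symmetric]) (rule f_eq, simp_all add: p' Y.act_closed Z.act_closed)
    qed (use s f' in auto)
    moreover have "compose (carrier Y) ?g p = f"
    proof (rule extensionalityI)
      fix y assume y: "y \<in> carrier Y"
      then have "f (?s (p y)) = f y"
        using s[OF p'(2)[OF y]] by (intro f_eq) auto
      then show "compose (carrier Y) ?g p y = f y"
        using y p'(2) by (simp add: compose_def)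
    qed (use f'(1) in auto)
    moreover have "h = h'" if "h \<in> right_module_hom R Z T" "h' \<in> right_module_hom R Z T"
        "compose (carrier Y) h p = compose (carrier Y) h' p" for h h'
    proof (rule right_module_hom_eqI[OF that(1,2)])
      fix z assume "z \<in> carrier Z"
      then show "h z = h' z"
        using fun_cong[OF that(3), of "?s z"] s[of z] by (simp add: compose_def)
    qed
    ultimately show "\<exists>!g. g \<in> Arr (right_module_cat R) Z T \<and> compose (carrier Y) g p = f"
      by (intro ex1I[of _ ?g]) auto
  qed
  ultimately show ?thesis
    using X Y Z i p by (simp add: short_exact_def)
qed

section \<open>Transport of modules\<close>

text \<open>Transport of structure along an injection, which brings modules on the element types of \<open>H\<close> and \<open>k\<close>
  into the universe of the module category.\<close>

definition transport_module :: "('b \<Rightarrow> 'u) \<Rightarrow> ('a, 'b, 'm) module_scheme \<Rightarrow> ('a, 'u) module" where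
  "transport_module j M =
     \<lparr>carrier = j ` carrier M, monoid.mult = undefined, one = undefined, ring.zero = j \<zero>\<^bsub>M\<^esub>,
      add = (\<lambda>x y. j (inv_into (carrier M) j x \<oplus>\<^bsub>M\<^esub> inv_into (carrier M) j y)),
      smult = (\<lambda>a x. j (a \<odot>\<^bsub>M\<^esub> inv_into (carrier M) j x))\<rparr>"

definition transport_hom ::
  "('b \<Rightarrow> 'u) \<Rightarrow> ('a, 'b, 'm) module_scheme \<Rightarrow> ('c \<Rightarrow> 'u) \<Rightarrow> ('b \<Rightarrow> 'c) \<Rightarrow> 'u \<Rightarrow> 'u" where
  "transport_hom j M j' f = (\<lambda>x\<in>j ` carrier M. j' (f (inv_into (carrier M) j x)))"

lemma transport_module_simps:
  assumes "inj_on j (carrier M)"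
  shows "carrier (transport_module j M) = j ` carrier M"
    and "\<zero>\<^bsub>transport_module j M\<^esub> = j \<zero>\<^bsub>M\<^esub>"
    and "x \<in> carrier M \<Longrightarrow> y \<in> carrier M \<Longrightarrow> j x \<oplus>\<^bsub>transport_module j M\<^esub> j y = j (x \<oplus>\<^bsub>M\<^esub> y)"
    and "x \<in> carrier M \<Longrightarrow> a \<odot>\<^bsub>transport_module j M\<^esub> j x = j (a \<odot>\<^bsub>M\<^esub> x)"
  using assms by (simp_all add: transport_module_def)

lemma transport_hom_apply:
  assumes "inj_on j (carrier M)" "x \<in> carrier M"
  shows "transport_hom j M j' f (j x) = j' (f x)"
  using assms by (simp add: transport_hom_def)

lemma right_module_transport:
  assumes "right_module R M" and j: "inj_on j (carrier M)"
  shows "right_module R (transport_module j M)"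
proof -
  interpret right_module R M by fact
  note [simp] = transport_module_simps[OF j]
  have "\<exists>y\<in>carrier M. j (x \<oplus>\<^bsub>M\<^esub> y) = j \<zero>\<^bsub>M\<^esub>" if "x \<in> carrier M" for x
    using that by (intro bexI[of _ "\<ominus>\<^bsub>M\<^esub> x"]) (simp_all add: M.r_neg)
  then have "abelian_group (transport_module j M)"
    by (intro abelian_groupI) (auto simp: M.a_ac)
  then show ?thesis
    by (intro right_module.intro right_module_axioms.intro R.ring_axioms)
      (auto simp: act_closed act_ring_distr act_distr act_assoc act_one)
qed

lemma transport_hom_in:
  assumes M: "right_module R M" and N: "right_module R N"
    and j: "inj_on j (carrier M)" and j': "inj_on j' (carrier N)"
    and "\<And>x. x \<in> carrier M \<Longrightarrow> f x \<in> carrier N"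
    and "\<And>x y. x \<in> carrier M \<Longrightarrow> y \<in> carrier M \<Longrightarrow> f (x \<oplus>\<^bsub>M\<^esub> y) = f x \<oplus>\<^bsub>N\<^esub> f y"
    and "\<And>a x. a \<in> carrier R \<Longrightarrow> x \<in> carrier M \<Longrightarrow> f (a \<odot>\<^bsub>M\<^esub> x) = a \<odot>\<^bsub>N\<^esub> f x"
  shows "transport_hom j M j' f \<in> right_module_hom R (transport_module j M) (transport_module j' N)"
proof -
  interpret M: right_module R M by fact
  note [simp] = transport_module_simps[OF j] transport_module_simps[OF j'] transport_hom_apply[OF j] assms(5-7)
  show ?thesis
  proof (rule right_module_homI)
    show "transport_hom j M j' f \<in> extensional (carrier (transport_module j M))"
      by (simp add: transport_hom_def)
  qed (auto simp: M.act_closed)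
qed

lemma restrict_transport_module:
  "restrict_scalars_module \<phi> (transport_module j M) = transport_module j (restrict_scalars_module \<phi> M)"
  by (simp add: restrict_scalars_module_def transport_module_def)

section \<open>Restriction of scalars along the unit of a Hopf algebra\<close>

definition regular_module :: "('h, 'm) ring_scheme \<Rightarrow> ('h, 'h) module" where
  "regular_module H = \<lparr>carrier = carrier H, monoid.mult = monoid.mult H, one = \<one>\<^bsub>H\<^esub>, ring.zero = \<zero>\<^bsub>H\<^esub>,
     add = add H, smult = (\<lambda>a x. x \<otimes>\<^bsub>H\<^esub> a)\<rparr>"

text \<open>The trivial right \<open>H\<close>-module \<open>k\<close>.\<close>

definition counit_module :: "('k, 'r) ring_scheme \<Rightarrow> ('h \<Rightarrow> 'k) \<Rightarrow> ('h, 'k) module" where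
  "counit_module k \<epsilon> = \<lparr>carrier = carrier k, monoid.mult = monoid.mult k, one = \<one>\<^bsub>k\<^esub>, ring.zero = \<zero>\<^bsub>k\<^esub>,
     add = add k, smult = (\<lambda>a r. r \<otimes>\<^bsub>k\<^esub> \<epsilon> a)\<rparr>"

definition augmentation_module ::
  "('k, 'r) ring_scheme \<Rightarrow> ('h, 'm) ring_scheme \<Rightarrow> ('h \<Rightarrow> 'k) \<Rightarrow> ('h, 'h) module" where
  "augmentation_module k H \<epsilon> = (regular_module H)\<lparr>carrier := {x \<in> carrier H. \<epsilon> x = \<zero>\<^bsub>k\<^esub>}\<rparr>"

lemma FObj_restriction [simp]: "FObj (restriction_of_scalars \<phi>) = restrict_scalars_module \<phi>"
  and FArr_restriction [simp]: "FArr (restriction_of_scalars \<phi>) M N f = f"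
  by (simp_all add: restriction_of_scalars_def)

lemma restrict_scalars_module_simps [simp]:
  "carrier (restrict_scalars_module \<phi> M) = carrier M"
  "\<zero>\<^bsub>restrict_scalars_module \<phi> M\<^esub> = \<zero>\<^bsub>M\<^esub>"
  "add (restrict_scalars_module \<phi> M) = add M"
  "r \<odot>\<^bsub>restrict_scalars_module \<phi> M\<^esub> x = \<phi> r \<odot>\<^bsub>M\<^esub> x"
  by (simp_all add: restrict_scalars_module_def)

context hopf_algebra
begin

lemma is_functor_restriction:
  "is_functor (right_module_cat H) (right_module_cat k) (restriction_of_scalars (algebra_unit H))"
  by (rule is_functor_restriction_of_scalars[OF R.ring_axioms algebra_unit_hom])

text \<open>The averaging operator \<open>(\<P> h) m = \<Sum> h (m S(t\<^sub>1)) t\<^sub>2\<close>. The map \<open>(p, q) \<mapsto> h (m p) q\<close> is balanced since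
  \<open>h\<close> is \<open>k\<close>-linear, so \<open>H\<close>-linearity of \<open>\<P> h\<close> is an instance of \<open>integral_casimir\<close>.\<close>

lemma integral_imp_separable:
  assumes t: "right_integral H \<epsilon> t" and \<epsilon>t: "\<epsilon> t = \<one>"
  shows "separable_functor (right_module_cat H :: (('b, 'u) module, 'u \<Rightarrow> 'u) cat)
    (right_module_cat k) (restriction_of_scalars (algebra_unit H))"
proof -
  have tH: "t \<in> carrier H"
    using t by (simp add: right_integral_def)
  let ?\<beta> = "\<lambda>M N h m p q. q \<odot>\<^bsub>N\<^esub> h (p \<odot>\<^bsub>M\<^esub> m)"
  define \<P> :: "('b, 'u) module \<Rightarrow> ('b, 'u) module \<Rightarrow> ('u \<Rightarrow> 'u) \<Rightarrow> 'u \<Rightarrow> 'u"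
    where "\<P> M N h = (\<lambda>m\<in>carrier M. sweedler N (\<lambda>p q. q \<odot>\<^bsub>N\<^esub> h (S p \<odot>\<^bsub>M\<^esub> m)) t)" for M N h
  have \<P>_hom: "\<P> M N h \<in> right_module_hom H M N"
    if M: "right_module H M" and N: "right_module H N"
      and h: "h \<in> right_module_hom k (restrict_scalars_module (algebra_unit H) M)
        (restrict_scalars_module (algebra_unit H) N)" for M N :: "('b, 'u) module" and h
  proof -
    interpret M: right_module H M by fact
    interpret N: right_module H N by fact
    note NA = N.M.abelian_group_axioms
    have h_cl [simp]: "h x \<in> carrier N" if "x \<in> carrier M" for x
      using right_module_homD(2)[OF h] that by simp
    have h_add: "h (x \<oplus>\<^bsub>M\<^esub> y) = h x \<oplus>\<^bsub>N\<^esub> h y" if "x \<in> carrier M" "y \<in> carrier M" for x y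
      using right_module_homD(3)[OF h] that by simp
    have h_smult: "h (algebra_unit H r \<odot>\<^bsub>M\<^esub> x) = algebra_unit H r \<odot>\<^bsub>N\<^esub> h x" if "r \<in> carrier k" "x \<in> carrier M" for r x
      using right_module_homD(4)[OF h] that by simp
    note [simp] = M.act_closed N.act_closed
    have scalar: "(r \<odot>\<^bsub>H\<^esub> p) \<odot>\<^bsub>M\<^esub> x = algebra_unit H r \<odot>\<^bsub>M\<^esub> (p \<odot>\<^bsub>M\<^esub> x)"
      if "r \<in> carrier k" "p \<in> carrier H" "x \<in> carrier M" for r p x
      using that M.act_assoc[of p "algebra_unit H r" x] by (simp add: algebra_unit_def smult_mult_right)
    have scalar': "(r \<odot>\<^bsub>H\<^esub> q) \<odot>\<^bsub>N\<^esub> x = q \<odot>\<^bsub>N\<^esub> (algebra_unit H r \<odot>\<^bsub>N\<^esub> x)"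
      if "r \<in> carrier k" "q \<in> carrier H" "x \<in> carrier N" for r q x
      using that N.act_assoc[of "algebra_unit H r" q x] by (simp add: algebra_unit_def smult_mult_left)
    have unit_closed [simp]: "algebra_unit H r \<in> carrier H" if "r \<in> carrier k" for r
      using that by (simp add: algebra_unit_def)
    have bal: "balanced k H H N (?\<beta> M N h m)" if m: "m \<in> carrier M" for m
      unfolding balanced_def using m
      by (simp add: M.act_ring_distr N.act_ring_distr N.act_distr h_add h_smult scalar scalar')
    show ?thesis
    proof (rule right_module_homI)
      show "\<P> M N h \<in> extensional (carrier M)"
        by (simp add: \<P>_def)
    next
      fix x assume "x \<in> carrier M"
      then show "\<P> M N h x \<in> carrier N"
        by (auto simp: \<P>_def intro!: sweedler_closed[OF NA tH])
    next
      fix x y assume "x \<in> carrier M" "y \<in> carrier M"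
      then show "\<P> M N h (x \<oplus>\<^bsub>M\<^esub> y) = \<P> M N h x \<oplus>\<^bsub>N\<^esub> \<P> M N h y"
        by (simp add: \<P>_def sweedler_plus[OF NA tH, symmetric])
          (rule sweedler_cong[OF NA tH]; simp add: M.act_distr N.act_distr h_add)
    next
      fix a x assume a: "a \<in> carrier H" and x: "x \<in> carrier M"
      have "\<P> M N h (a \<odot>\<^bsub>M\<^esub> x) = sweedler N (\<lambda>p q. ?\<beta> M N h x (a \<otimes>\<^bsub>H\<^esub> S p) q) t"
        using a x by (simp add: \<P>_def) (rule sweedler_cong[OF NA tH]; simp add: M.act_assoc)
      also have "\<dots> = sweedler N (\<lambda>p q. ?\<beta> M N h x (S p) (q \<otimes>\<^bsub>H\<^esub> a)) t"
        by (rule integral_casimir[OF t a NA bal[OF x]])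
      also have "\<dots> = sweedler N (\<lambda>p q. a \<odot>\<^bsub>N\<^esub> ?\<beta> M N h x (S p) q) t"
        using a x by (intro sweedler_cong[OF NA tH]) (simp_all add: N.act_assoc)
      also have "\<dots> = a \<odot>\<^bsub>N\<^esub> \<P> M N h x"
        unfolding \<P>_def using a x by (simp add: N.act_distr sweedler_additive[OF NA NA tH, of "\<lambda>y. a \<odot>\<^bsub>N\<^esub> y"])
      finally show "\<P> M N h (a \<odot>\<^bsub>M\<^esub> x) = a \<odot>\<^bsub>N\<^esub> \<P> M N h x" .
    qed
  qed
  have \<P>_nat: "\<P> X T (compose (carrier X) v (compose (carrier X) h u))
      = compose (carrier X) v (compose (carrier X) (\<P> Y Z h) u)"
    if X: "right_module H X" and Y: "right_module H Y" and Z: "right_module H Z" and T: "right_module H T"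
      and u: "u \<in> right_module_hom H X Y" and v: "v \<in> right_module_hom H Z T"
      and h: "h \<in> right_module_hom k (restrict_scalars_module (algebra_unit H) Y)
        (restrict_scalars_module (algebra_unit H) Z)" for X Y Z T :: "('b, 'u) module" and u v h
  proof
    fix m
    interpret X: right_module H X by fact
    interpret Y: right_module H Y by fact
    interpret Z: right_module H Z by fact
    interpret T: right_module H T by fact
    note u' = right_module_homD[OF u] and v' = right_module_homD[OF v]
    have h_cl: "h x \<in> carrier Z" if "x \<in> carrier Y" for x
      using right_module_homD(2)[OF h] that by simp
    show "\<P> X T (compose (carrier X) v (compose (carrier X) h u)) m
      = compose (carrier X) v (compose (carrier X) (\<P> Y Z h) u) m"
    proof (cases "m \<in> carrier X")
      case m: True
      have "\<P> X T (compose (carrier X) v (compose (carrier X) h u)) m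
        = sweedler T (\<lambda>p q. v (q \<odot>\<^bsub>Z\<^esub> h (S p \<odot>\<^bsub>Y\<^esub> u m))) t"
        using m by (simp add: \<P>_def)
          (rule sweedler_cong[OF T.M.abelian_group_axioms tH];
            simp add: compose_def X.act_closed Y.act_closed Z.act_closed T.act_closed u' v' h_cl)
      also have "\<dots> = v (sweedler Z (\<lambda>p q. q \<odot>\<^bsub>Z\<^esub> h (S p \<odot>\<^bsub>Y\<^esub> u m)) t)"
        using m by (intro sweedler_additive[OF Z.M.abelian_group_axioms T.M.abelian_group_axioms tH, symmetric])
          (simp_all add: Y.act_closed Z.act_closed u' v' h_cl)
      also have "\<dots> = compose (carrier X) v (compose (carrier X) (\<P> Y Z h) u) m"
        using m by (simp add: compose_def \<P>_def u')
      finally show ?thesis .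
    qed (simp add: \<P>_def compose_def)
  qed
  have \<P>_id: "\<P> M N f = f"
    if M: "right_module H M" and N: "right_module H N" and f: "f \<in> right_module_hom H M N" for M N :: "('b, 'u) module" and f
  proof (rule extensionalityI)
    interpret M: right_module H M by fact
    interpret N: right_module H N by fact
    note f' = right_module_homD[OF f]
    show "f \<in> extensional (carrier M)"
      by (rule f'(1))
    fix m assume m: "m \<in> carrier M"
    have "\<P> M N f m = sweedler N (\<lambda>p q. (S p \<otimes>\<^bsub>H\<^esub> q) \<odot>\<^bsub>N\<^esub> f m) t"
      using m by (simp add: \<P>_def)
        (rule sweedler_cong[OF N.M.abelian_group_axioms tH]; simp add: f' N.act_assoc N.act_closed)
    also have "\<dots> = sweedler H (\<lambda>p q. S p \<otimes>\<^bsub>H\<^esub> q) t \<odot>\<^bsub>N\<^esub> f m"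
      using m by (intro sweedler_additive[OF H_abelian N.M.abelian_group_axioms tH, symmetric])
        (simp_all add: f' N.act_closed N.act_ring_distr)
    also have "\<dots> = f m"
      using m by (simp add: antipode_left[OF tH] \<epsilon>t f' N.act_one)
    finally show "\<P> M N f m = f m" .
  qed (simp add: \<P>_def)
  show ?thesis
    unfolding separable_functor_def
    using \<P>_hom \<P>_nat \<P>_id by (intro exI[of _ \<P>]) simp
qed

section \<open>The augmentation sequence\<close>

lemma \<epsilon>_ring_hom: "ring_hom_ring H k \<epsilon>"
  by (intro ring_hom_ring.intro ring_hom_ring_axioms.intro H.ring_axioms R.ring_axioms \<epsilon>_hom)

lemma \<epsilon>_simps:
  shows "\<epsilon> \<one>\<^bsub>H\<^esub> = \<one>" "\<epsilon> \<zero>\<^bsub>H\<^esub> = \<zero>"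
    and "x \<in> carrier H \<Longrightarrow> y \<in> carrier H \<Longrightarrow> \<epsilon> (x \<oplus>\<^bsub>H\<^esub> y) = \<epsilon> x \<oplus> \<epsilon> y"
    and "x \<in> carrier H \<Longrightarrow> y \<in> carrier H \<Longrightarrow> \<epsilon> (x \<otimes>\<^bsub>H\<^esub> y) = \<epsilon> x \<otimes> \<epsilon> y"
    and "x \<in> carrier H \<Longrightarrow> \<epsilon> (\<ominus>\<^bsub>H\<^esub> x) = \<ominus> \<epsilon> x"
    and "r \<in> carrier k \<Longrightarrow> \<epsilon> (algebra_unit H r) = r"
proof -
  interpret \<epsilon>: ring_hom_ring H k \<epsilon> by (rule \<epsilon>_ring_hom)
  show 1: "\<epsilon> \<one>\<^bsub>H\<^esub> = \<one>" "\<epsilon> \<zero>\<^bsub>H\<^esub> = \<zero>"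
    "x \<in> carrier H \<Longrightarrow> y \<in> carrier H \<Longrightarrow> \<epsilon> (x \<oplus>\<^bsub>H\<^esub> y) = \<epsilon> x \<oplus> \<epsilon> y"
    "x \<in> carrier H \<Longrightarrow> y \<in> carrier H \<Longrightarrow> \<epsilon> (x \<otimes>\<^bsub>H\<^esub> y) = \<epsilon> x \<otimes> \<epsilon> y"
    "x \<in> carrier H \<Longrightarrow> \<epsilon> (\<ominus>\<^bsub>H\<^esub> x) = \<ominus> \<epsilon> x"
    by simp_all
  show "r \<in> carrier k \<Longrightarrow> \<epsilon> (algebra_unit H r) = r"
    by (simp add: algebra_unit_def \<epsilon>_smult)
qed

lemma unit_closed: "r \<in> carrier k \<Longrightarrow> algebra_unit H r \<in> carrier H"
  by (simp add: algebra_unit_def)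

lemma mult_unit: "r \<in> carrier k \<Longrightarrow> x \<in> carrier H \<Longrightarrow> x \<otimes>\<^bsub>H\<^esub> algebra_unit H r = r \<odot>\<^bsub>H\<^esub> x"
  by (simp add: algebra_unit_def smult_mult_right)

lemma right_module_regular: "right_module H (regular_module H)"
proof -
  have "abelian_group (regular_module H)"
    by (rule abelian_groupI)
      (auto simp: regular_module_def M.a_ac intro: bexI[of _ "\<ominus>\<^bsub>H\<^esub> _"] M.l_neg)
  then show ?thesis
    by (intro right_module.intro right_module_axioms.intro H.ring_axioms)
      (auto simp: regular_module_def H.l_distr H.r_distr H.m_assoc)
qed

lemma right_module_counit: "right_module H (counit_module k \<epsilon>)"
proof -
  have "abelian_group (counit_module k \<epsilon>)"
    by (rule abelian_groupI)
      (auto simp: counit_module_def R.a_ac intro: bexI[of _ "\<ominus> _"] R.l_neg)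
  then show ?thesis
    by (intro right_module.intro right_module_axioms.intro H.ring_axioms)
      (auto simp: counit_module_def R.l_distr R.r_distr R.m_ac \<epsilon>_simps)
qed

lemma right_module_augmentation: "right_module H (augmentation_module k H \<epsilon>)"
proof -
  have "\<exists>y\<in>carrier H. \<epsilon> y = \<zero> \<and> x \<oplus>\<^bsub>H\<^esub> y = \<zero>\<^bsub>H\<^esub>" if "x \<in> carrier H" "\<epsilon> x = \<zero>" for x
    using that by (intro bexI[of _ "\<ominus>\<^bsub>H\<^esub> x"]) (simp_all add: M.r_neg \<epsilon>_simps)
  then have "abelian_group (augmentation_module k H \<epsilon>)"
    by (intro abelian_groupI)
      (auto simp: augmentation_module_def regular_module_def M.a_ac \<epsilon>_simps)
  then show ?thesis
    by (intro right_module.intro right_module_axioms.intro H.ring_axioms)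
      (auto simp: augmentation_module_def regular_module_def H.l_distr H.r_distr H.m_assoc \<epsilon>_simps)
qed

end

text \<open>Copies of the augmentation sequence inside a type into which the carrier of \<open>H\<close> embeds. The
  trivial module is embedded through the unit \<open>k \<rightarrow> H\<close>.\<close>

locale hopf_universe = hopf_algebra k H \<Delta> \<epsilon> S
  for k :: "('k, 'r) ring_scheme" (structure) and H :: "('k, 'h, 'm) module_scheme" (structure)
    and \<Delta> \<epsilon> S +
  fixes j :: "'h \<Rightarrow> 'u"
  assumes inj_j: "inj_on j (carrier H)"
begin

abbreviation "j' \<equiv> j \<circ> algebra_unit H"

abbreviation "U_H \<equiv> transport_module j (regular_module H)"
abbreviation "U_k \<equiv> transport_module j' (counit_module k \<epsilon>)"
abbreviation "U_I \<equiv> transport_module j (augmentation_module k H \<epsilon>)"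
abbreviation "U_\<epsilon> \<equiv> transport_hom j (regular_module H) j' \<epsilon>"
abbreviation "U_\<iota> \<equiv> transport_hom j (augmentation_module k H \<epsilon>) j (\<lambda>x. x)"
abbreviation "res \<equiv> restrict_scalars_module (algebra_unit H)"

lemma carriers [simp]:
  "carrier (regular_module H) = carrier H"
  "carrier (counit_module k \<epsilon>) = carrier k"
  "carrier (augmentation_module k H \<epsilon>) = {x \<in> carrier H. \<epsilon> x = \<zero>}"
  by (simp_all add: regular_module_def counit_module_def augmentation_module_def)

lemma operations [simp]:
  "x \<oplus>\<^bsub>regular_module H\<^esub> y = x \<oplus>\<^bsub>H\<^esub> y"
  "a \<odot>\<^bsub>regular_module H\<^esub> x = x \<otimes>\<^bsub>H\<^esub> a"
  "r \<oplus>\<^bsub>counit_module k \<epsilon>\<^esub> s = r \<oplus> s"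
  "a \<odot>\<^bsub>counit_module k \<epsilon>\<^esub> r = r \<otimes> \<epsilon> a"
  "x \<oplus>\<^bsub>augmentation_module k H \<epsilon>\<^esub> y = x \<oplus>\<^bsub>H\<^esub> y"
  "a \<odot>\<^bsub>augmentation_module k H \<epsilon>\<^esub> x = x \<otimes>\<^bsub>H\<^esub> a"
  "\<zero>\<^bsub>counit_module k \<epsilon>\<^esub> = \<zero>"
  by (simp_all add: regular_module_def counit_module_def augmentation_module_def)

lemma inj:
  "inj_on j (carrier (regular_module H))"
  "inj_on j' (carrier (counit_module k \<epsilon>))"
  "inj_on j (carrier (augmentation_module k H \<epsilon>))"
proof -
  show "inj_on j (carrier (regular_module H))"
    using inj_j by simp
  show "inj_on j (carrier (augmentation_module k H \<epsilon>))"
    using inj_j by (rule inj_on_subset) auto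
  have "inj_on (algebra_unit H) (carrier k)"
    by (rule inj_on_inverseI[of _ \<epsilon>]) (rule \<epsilon>_simps)
  then show "inj_on j' (carrier (counit_module k \<epsilon>))"
    using inj_on_subset[OF inj_j, of "algebra_unit H ` carrier k"] unit_closed by (auto intro!: comp_inj_on)
qed

lemmas U_H_simps = transport_module_simps[OF inj(1), simplified]
lemmas U_k_simps = transport_module_simps[OF inj(2), simplified]
lemmas U_I_simps = transport_module_simps[OF inj(3), simplified]

lemma U_modules: "right_module H U_H" "right_module H U_k" "right_module H U_I"
  by (intro right_module_transport right_module_regular right_module_counit right_module_augmentation inj)+

lemma res_module: "right_module H M \<Longrightarrow> right_module k (res M)"
  by (rule right_module_restrict_scalars[OF R.ring_axioms algebra_unit_hom])

lemma U_\<epsilon>_hom: "U_\<epsilon> \<in> right_module_hom H U_H U_k"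
  by (rule transport_hom_in[OF right_module_regular right_module_counit inj(1,2)])
    (simp_all add: \<epsilon>_simps)

lemma U_\<iota>_hom: "U_\<iota> \<in> right_module_hom H U_I U_H"
  by (rule transport_hom_in[OF right_module_augmentation right_module_regular inj(3,1)]) simp_all

lemma U_\<epsilon>_apply: "x \<in> carrier H \<Longrightarrow> U_\<epsilon> (j x) = j' (\<epsilon> x)"
  by (simp add: transport_hom_apply[OF inj(1)])

lemma U_\<iota>_apply: "x \<in> carrier H \<Longrightarrow> \<epsilon> x = \<zero> \<Longrightarrow> U_\<iota> (j x) = j x"
  by (simp add: transport_hom_apply[OF inj(3)])

lemma res_hom: "f \<in> right_module_hom H M N \<Longrightarrow> f \<in> right_module_hom k (res M) (res N)"
  by (rule right_module_homI) (auto simp: right_module_homD unit_closed)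

text \<open>The unit \<open>r \<mapsto> r 1\<close> is a \<open>k\<close>-linear section of \<open>\<epsilon>\<close>.\<close>

lemma U_\<epsilon>_right_inverse: "has_right_inverse (right_module_cat k) (res U_H) (res U_k) U_\<epsilon>"
proof -
  let ?s = "transport_hom j' (res (counit_module k \<epsilon>)) j (algebra_unit H)"
  have "?s \<in> right_module_hom k (res U_k) (res U_H)"
    unfolding restrict_transport_module
    by (rule transport_hom_in[OF res_module[OF right_module_counit] res_module[OF right_module_regular]])
      (use inj ring_hom_add[OF algebra_unit_hom] ring_hom_mult[OF algebra_unit_hom]
        in \<open>auto simp: unit_closed \<epsilon>_simps\<close>)
  moreover have "?s (j' r) = j (algebra_unit H r)" if "r \<in> carrier k" for r
    using transport_hom_apply[of j' "res (counit_module k \<epsilon>)" r j "algebra_unit H"] inj(2) that by simp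
  then have "compose (carrier U_k) U_\<epsilon> ?s = (\<lambda>x\<in>carrier U_k. x)"
    by (auto simp: fun_eq_iff compose_def U_k_simps U_\<epsilon>_apply unit_closed \<epsilon>_simps)
  ultimately show ?thesis
    unfolding has_right_inverse_def by auto
qed

text \<open>The map \<open>x \<mapsto> x - \<epsilon>(x) 1\<close> is a \<open>k\<close>-linear projection onto the augmentation ideal.\<close>

lemma U_\<iota>_left_inverse: "has_left_inverse (right_module_cat k) (res U_I) (res U_H) U_\<iota>"
proof -
  let ?f = "\<lambda>x. x \<oplus>\<^bsub>H\<^esub> \<ominus>\<^bsub>H\<^esub> algebra_unit H (\<epsilon> x)"
  let ?r = "transport_hom j (res (regular_module H)) j ?f"
  have "?r \<in> right_module_hom k (res U_H) (res U_I)"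
    unfolding restrict_transport_module
  proof (rule transport_hom_in[OF res_module[OF right_module_regular] res_module[OF right_module_augmentation]])
    fix x assume "x \<in> carrier (res (regular_module H))"
    then show "?f x \<in> carrier (res (augmentation_module k H \<epsilon>))"
      by (simp add: unit_closed \<epsilon>_simps R.r_neg)
  next
    fix x y assume "x \<in> carrier (res (regular_module H))" "y \<in> carrier (res (regular_module H))"
    then show "?f (x \<oplus>\<^bsub>res (regular_module H)\<^esub> y) = ?f x \<oplus>\<^bsub>res (augmentation_module k H \<epsilon>)\<^esub> ?f y"
      by (simp add: unit_closed \<epsilon>_simps ring_hom_add[OF algebra_unit_hom] M.minus_add M.a_ac)
  next
    fix a x assume "a \<in> carrier k" "x \<in> carrier (res (regular_module H))"
    then show "?f (a \<odot>\<^bsub>res (regular_module H)\<^esub> x) = a \<odot>\<^bsub>res (augmentation_module k H \<epsilon>)\<^esub> ?f x"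
      by (simp add: unit_closed \<epsilon>_simps ring_hom_mult[OF algebra_unit_hom] H.l_distr H.l_minus)
  qed (use inj in auto)
  moreover have "?r (j x) = j x" if "x \<in> carrier H" "\<epsilon> x = \<zero>" for x
    using transport_hom_apply[of j "res (regular_module H)" x j ?f] inj(1) that
    by (simp add: algebra_unit_def)
  then have "compose (carrier U_I) ?r U_\<iota> = (\<lambda>x\<in>carrier U_I. x)"
    by (auto simp: fun_eq_iff compose_def U_I_simps U_\<iota>_apply)
  ultimately show ?thesis
    unfolding has_left_inverse_def by auto
qed

text \<open>The integral is \<open>t = s 1\<close>. Both \<open>h\<close> and \<open>\<epsilon>(h) 1\<close> act on \<open>1\<close> in the trivial module as \<open>\<epsilon>(h)\<close>, so
  \<open>H\<close>-linearity of \<open>s\<close> gives \<open>t h = t (\<epsilon>(h) 1)\<close>.\<close>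

lemma integral_of_section:
  assumes "has_right_inverse (right_module_cat H) U_H U_k U_\<epsilon>"
  shows "\<exists>t. right_integral H \<epsilon> t \<and> \<epsilon> t = \<one>"
proof -
  obtain s where s: "s \<in> right_module_hom H U_k U_H"
    and \<epsilon>s': "compose (carrier U_k) U_\<epsilon> s = (\<lambda>x\<in>carrier U_k. x)"
    using assms unfolding has_right_inverse_def by auto
  have \<epsilon>s: "U_\<epsilon> (s x) = x" if "x \<in> carrier U_k" for x
    using fun_cong[OF \<epsilon>s', of x] that by (simp add: compose_def)
  note s' = right_module_homD[OF s]
  have one: "j' \<one> \<in> carrier U_k"
    by (simp add: U_k_simps)
  then obtain t where t: "t \<in> carrier H" "s (j' \<one>) = j t"
    using s'(2)[OF one] by (auto simp: U_H_simps)
  have "j' (\<epsilon> t) = j' \<one>"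
    using \<epsilon>s[OF one] t by (simp add: U_\<epsilon>_apply)
  then have "\<epsilon> t = \<one>"
    using inj(2) t by (auto simp: inj_on_def)
  moreover have "t \<otimes>\<^bsub>H\<^esub> h = \<epsilon> h \<odot>\<^bsub>H\<^esub> t" if h: "h \<in> carrier H" for h
  proof -
    have act: "s (j' (\<epsilon> a)) = j (t \<otimes>\<^bsub>H\<^esub> a)" if "a \<in> carrier H" for a
      using s'(4)[OF that one] that t U_k_simps(4)[of "\<one>" a] by (simp add: U_H_simps)
    have "j (t \<otimes>\<^bsub>H\<^esub> h) = j (t \<otimes>\<^bsub>H\<^esub> algebra_unit H (\<epsilon> h))"
      using act[OF h] act[of "algebra_unit H (\<epsilon> h)"] h by (simp add: unit_closed \<epsilon>_simps)
    then have "t \<otimes>\<^bsub>H\<^esub> h = t \<otimes>\<^bsub>H\<^esub> algebra_unit H (\<epsilon> h)"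
      using inj_j h t by (auto simp: inj_on_def unit_closed)
    then show ?thesis
      using h t by (simp add: mult_unit)
  qed
  ultimately show ?thesis
    using t by (auto simp: right_integral_def)
qed

text \<open>Let \<open>e = g 1\<close>. Since \<open>g\<close> is \<open>H\<close>-linear and the identity on \<open>ker \<epsilon>\<close>, \<open>e\<close> is a left unit for \<open>ker \<epsilon>\<close>, so
  \<open>t = 1 - e\<close> kills \<open>ker \<epsilon>\<close> from the left. As \<open>h - \<epsilon>(h) 1\<close> lies in \<open>ker \<epsilon>\<close>, \<open>t\<close> is an integral.\<close>

lemma integral_of_retraction:
  assumes "has_left_inverse (right_module_cat H) U_I U_H U_\<iota>"
  shows "\<exists>t. right_integral H \<epsilon> t \<and> \<epsilon> t = \<one>"
proof -
  obtain g where g: "g \<in> right_module_hom H U_H U_I"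
    and g\<iota>: "compose (carrier U_I) g U_\<iota> = (\<lambda>x\<in>carrier U_I. x)"
    using assms unfolding has_left_inverse_def by auto
  have g_id: "g (j x) = j x" if "x \<in> carrier H" "\<epsilon> x = \<zero>" for x
    using fun_cong[OF g\<iota>, of "j x"] that by (simp add: compose_def U_I_simps U_\<iota>_apply)
  note g' = right_module_homD[OF g]
  have one: "j \<one>\<^bsub>H\<^esub> \<in> carrier U_H"
    by (simp add: U_H_simps)
  obtain e where e: "e \<in> carrier H" "\<epsilon> e = \<zero>" "g (j \<one>\<^bsub>H\<^esub>) = j e"
    using g'(2)[OF one] by (auto simp: U_I_simps)
  have e_mult: "e \<otimes>\<^bsub>H\<^esub> x = x" if x: "x \<in> carrier H" "\<epsilon> x = \<zero>" for x
  proof -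
    have "j x = g (j x)"
      using g_id[OF x] by simp
    also have "\<dots> = j (e \<otimes>\<^bsub>H\<^esub> x)"
      using g'(4)[OF x(1) one] U_H_simps(4)[of "\<one>\<^bsub>H\<^esub>" x] U_I_simps(4)[of e x] e x by simp
    finally show ?thesis
      using inj_j e x by (auto simp: inj_on_def)
  qed
  define t where "t = \<one>\<^bsub>H\<^esub> \<oplus>\<^bsub>H\<^esub> \<ominus>\<^bsub>H\<^esub> e"
  have t: "t \<in> carrier H" "\<epsilon> t = \<one>"
    using e by (simp_all add: t_def \<epsilon>_simps)
  have "t \<otimes>\<^bsub>H\<^esub> h = \<epsilon> h \<odot>\<^bsub>H\<^esub> t" if h: "h \<in> carrier H" for h
  proof -
    let ?u = "algebra_unit H (\<epsilon> h)"
    let ?d = "h \<oplus>\<^bsub>H\<^esub> \<ominus>\<^bsub>H\<^esub> ?u"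
    have u: "?u \<in> carrier H"
      using h by (simp add: unit_closed)
    have d: "?d \<in> carrier H" "\<epsilon> ?d = \<zero>" "?d \<oplus>\<^bsub>H\<^esub> ?u = h"
      using h u by (simp_all add: \<epsilon>_simps R.r_neg M.a_assoc M.l_neg)
    have "t \<otimes>\<^bsub>H\<^esub> ?d = \<zero>\<^bsub>H\<^esub>"
      using e d(1) e_mult[OF d(1,2)] by (simp add: t_def H.l_distr H.l_minus M.r_neg del: H.r_distr)
    then have "t \<otimes>\<^bsub>H\<^esub> (?d \<oplus>\<^bsub>H\<^esub> ?u) = t \<otimes>\<^bsub>H\<^esub> ?u"
      using t d(1) u by (subst H.r_distr) simp_all
    then show ?thesis
      using h t by (simp add: d(3) mult_unit)
  qed
  then show ?thesis
    using t by (auto simp: right_integral_def)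
qed

abbreviation "M_H \<equiv> (right_module_cat H :: (('h, 'u) module, 'u \<Rightarrow> 'u) cat)"
abbreviation "M_k \<equiv> (right_module_cat k :: (('k, 'u) module, 'u \<Rightarrow> 'u) cat)"
abbreviation "G \<equiv> restriction_of_scalars (algebra_unit H) :: (('h, 'u) module, 'u \<Rightarrow> 'u, ('k, 'u) module, 'u \<Rightarrow> 'u) func"

lemma short_exact_augmentation:
  "short_exact M_H U_I U_H U_k U_\<iota> U_\<epsilon>"
  "short_exact M_k (res U_I) (res U_H) (res U_k) U_\<iota> U_\<epsilon>"
proof -
  have "inj_on U_\<iota> (carrier U_I)"
    by (auto simp: inj_on_def U_I_simps U_\<iota>_apply)
  moreover have "U_\<epsilon> ` carrier U_H = carrier U_k"
  proof
    show "U_\<epsilon> ` carrier U_H \<subseteq> carrier U_k"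
      by (rule image_subsetI) (rule right_module_homD(2)[OF U_\<epsilon>_hom])
    show "carrier U_k \<subseteq> U_\<epsilon> ` carrier U_H"
    proof
      fix x assume "x \<in> carrier U_k"
      then obtain r where r: "r \<in> carrier k" "x = j' r"
        by (auto simp: U_k_simps)
      then have "x = U_\<epsilon> (j (algebra_unit H r))"
        by (simp add: U_\<epsilon>_apply unit_closed \<epsilon>_simps)
      then show "x \<in> U_\<epsilon> ` carrier U_H"
        using r by (simp add: U_H_simps unit_closed)
    qed
  qed
  moreover have "{y \<in> carrier U_H. U_\<epsilon> y = \<zero>\<^bsub>U_k\<^esub>} = U_\<iota> ` carrier U_I"
  proof -
    have "j' (\<epsilon> x) = j' \<zero> \<longleftrightarrow> \<epsilon> x = \<zero>" if "x \<in> carrier H" for x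
      using inj_on_eq_iff[OF inj(2), of "\<epsilon> x" "\<zero>"] that by simp
    then have "{y \<in> carrier U_H. U_\<epsilon> y = \<zero>\<^bsub>U_k\<^esub>} = j ` {x \<in> carrier H. \<epsilon> x = \<zero>}"
      unfolding U_H_simps(1) U_k_simps(2) using U_\<epsilon>_apply by auto
    also have "\<dots> = U_\<iota> ` carrier U_I"
      unfolding U_I_simps(1) image_image by (intro image_cong) (simp_all add: U_\<iota>_apply)
    finally show ?thesis .
  qed
  ultimately show "short_exact M_H U_I U_H U_k U_\<iota> U_\<epsilon>"
    "short_exact M_k (res U_I) (res U_H) (res U_k) U_\<iota> U_\<epsilon>"
    using U_modules U_\<iota>_hom U_\<epsilon>_hom
    by (intro short_exact_right_module_cat; simp add: res_module res_hom)+
qed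

lemma semisimple_imp_integral:
  assumes "semisimple_functor M_H M_k G"
  shows "\<exists>t. right_integral H \<epsilon> t \<and> \<epsilon> t = \<one>"
proof -
  have "split_exact M_k (res U_I) (res U_H) (res U_k) U_\<iota> U_\<epsilon>"
    unfolding split_exact_def using short_exact_augmentation(2) U_\<epsilon>_right_inverse ..
  then have "split_exact M_H U_I U_H U_k U_\<iota> U_\<epsilon>"
    using assms short_exact_augmentation(1) unfolding semisimple_functor_def by simp
  then show ?thesis
    by (intro integral_of_section) (simp add: split_exact_def)
qed

lemma maschke_imp_integral:
  assumes "maschke_functor M_H M_k G"
  shows "\<exists>t. right_integral H \<epsilon> t \<and> \<epsilon> t = \<one>"
proof (rule integral_of_retraction)
  have "relative_injective M_H M_k G U_I"
    using assms U_modules by (simp add: maschke_functor_def)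
  then have "\<exists>g\<in>right_module_hom H U_H U_I. Ident M_H U_I = compose (carrier U_I) g U_\<iota>"
    using U_modules U_\<iota>_hom U_\<iota>_left_inverse is_category.Ident_in[OF is_category_right_module_cat, of U_I H]
    by (simp add: relative_injective_def)
  then show "has_left_inverse M_H U_I U_H U_\<iota>"
    unfolding has_left_inverse_def by auto
qed

lemma maschke_equivalences:
  "(dual_maschke_functor M_H M_k G \<longleftrightarrow> maschke_functor M_H M_k G) \<and>
   (maschke_functor M_H M_k G \<longleftrightarrow> semisimple_functor M_H M_k G) \<and>
   (semisimple_functor M_H M_k G \<longleftrightarrow> (\<exists>t. right_integral H \<epsilon> t \<and> \<epsilon> t = \<one>)) \<and>
   ((\<exists>t. right_integral H \<epsilon> t \<and> \<epsilon> t = \<one>) \<longleftrightarrow> separable_functor M_H M_k G)"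
proof -
  interpret G: is_functor M_H M_k G
    by (rule is_functor_restriction)
  show ?thesis
    using G.separable_imp_dual_maschke G.separable_imp_maschke G.dual_maschke_imp_semisimple
      integral_imp_separable semisimple_imp_integral maschke_imp_integral by blast
qed

end

theorem proposition5p7:
  fixes k :: "('k, 'r) ring_scheme" and H :: "('k, 'h, 'm) module_scheme"
    and \<Delta> :: "'h \<Rightarrow> ('h \<times> 'h \<Rightarrow>\<^sub>0 int) set" and \<epsilon> :: "'h \<Rightarrow> 'k" and S :: "'h \<Rightarrow> 'h"
  assumes hopf: "hopf_algebra k H \<Delta> \<epsilon> S"
    and universe: "carrier H \<lesssim> (UNIV :: 'u set)"
  shows
    "let M_H = (right_module_cat H :: (('h, 'u) module, 'u \<Rightarrow> 'u) cat);
         M_k = (right_module_cat k :: (('k, 'u) module, 'u \<Rightarrow> 'u) cat);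
         G = restriction_of_scalars (algebra_unit H);
         integral = (\<exists>t. right_integral H \<epsilon> t \<and> \<epsilon> t = \<one>\<^bsub>k\<^esub>)
     in (dual_maschke_functor M_H M_k G \<longleftrightarrow> maschke_functor M_H M_k G) \<and>
        (maschke_functor M_H M_k G \<longleftrightarrow> semisimple_functor M_H M_k G) \<and>
        (semisimple_functor M_H M_k G \<longleftrightarrow> integral) \<and>
        (integral \<longleftrightarrow> separable_functor M_H M_k G)"
proof -
  obtain j :: "'h \<Rightarrow> 'u" where "inj_on j (carrier H)"
    using universe unfolding lepoll_def by blast
  then interpret hopf_universe k H \<Delta> \<epsilon> S j
    using hopf by (intro hopf_universe.intro hopf_universe_axioms.intro)
  show ?thesis
    unfolding Let_def by (rule maschke_equivalences)
qed

end
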